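(* Let $X_1,\dots,X_n$ be independent with $\mathbb{E}(\psi_i(X_i))<\infty$ for $1\le i\le n$, let $S\subset\{1,\dots,n\}$ with $|S|\ge 2$, and let $\mathbb{G}_S(t_S)=\int\prod_{i\in S}\bigl(e^{\mathrm{i}x_i\cdot t_i}-f_{X_i}(t_i)\bigr)\,d\mathbb{W}(\mathbf{F}_{\mathbf X}(x))$. Then $$\|\mathbb{G}_S\|_{\rho_S}^2=\iint\prod_{i\in S}\Psi_i(x_i,y_i)\,d\mathbb{W}(\mathbf{F}_{\mathbf X}(x))\,d\mathbb{W}(\mathbf{F}_{\mathbf X}(y))\qquad\mathbb{P}\text{-a.s.},$$ with $$\Psi_i(x_i,y_i):=-\psi_i(x_i-y_i)+\mathbb{E}(\psi_i(X_i-y_i))+\mathbb{E}(\psi_i(x_i-X_i'))-\mathbb{E}(\psi_i(X_i-X_i')),$$ where $(X_1',\dots,X_n')$ is an independent copy of $(X_1,\dots,X_n)$.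
   Context: Each $X_i$ takes values in $\mathbb{R}^{d_i}$, has characteristic function $f_{X_i}(t_i)=\mathbb{E}(e^{\mathrm{i}X_i\cdot t_i})$ and distribution function $F_{X_i}$; $\mathbf{F}_{\mathbf X}(x)=(F_{X_1}(x_1),\dots,F_{X_n}(x_n))$. For each $i$, $\rho_i$ is a symmetric measure with full support on $\mathbb{R}^{d_i}$ with $\int 1\wedge|t_i|^2\,\rho_i(dt_i)<\infty$; $\psi_i(x_i)=\int_{\mathbb{R}^{d_i}}1-\cos(x_i\cdot t_i)\,\rho_i(dt_i)$; $\rho_S=\bigotimes_{i\in S}\rho_i$; $t_S=(t_i)_{i\in S}$; $\|g\|_{\rho_S}^2=\int|g(t_S)|^2\,\rho_S(dt_S)$. $\mathbb{W}$ is a Brownian sheet indexed by $[0,1]^n$. Write $P=\bigotimes_{i=1}^n P_{X_i}$ for the product of the laws of the $X_i$. The stochastic integral $g\mapsto\int g(x)\,d\mathbb{W}(\mathbf{F}_{\mathbf X}(x))$ is the (complex-linear) Wiener integral on $L^2(P)$: the integrals of real $g$ are real centered jointly Gaussian random variables, and for all $f,g$ the isometry $\mathbb{E}\bigl(\int f\,d\mathbb{W}(\mathbf{F}_{\mathbf X})\cdot\int g\,d\mathbb{W}(\mathbf{F}_{\mathbf X})\bigr)=\int fg\,dP$ holds. For $\mathbb{G}_S$ a jointly measurable version in $(t_S,\omega)$ is taken. The double integral is the iterated one without removal of the diagonal: it is the unique continuous linear extension (with values in $L^1(\mathbb{P})$) to the projective tensor product $L^2(P)\hat\otimes_\pi L^2(P)$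 of the map sending a product kernel $g(x)h(y)$ to $\int g\,d\mathbb{W}(\mathbf{F}_{\mathbf X})\cdot\int h\,d\mathbb{W}(\mathbf{F}_{\mathbf X})$. *)

theory Defs
  imports "HOL-Probability.Probability"
begin

text \<open>Since the dimensions \<open>d i\<close> depend on \<open>i\<close>, a vector of \<open>\<real>\<^sup>d\<close> is a function on \<open>{..<d}\<close>,
  extended by \<open>undefined\<close>; its Borel \<open>\<sigma>\<close>-algebra is the finite product \<open>\<sigma>\<close>-algebra.\<close>

definition euc :: "nat \<Rightarrow> (nat \<Rightarrow> real) measure" where
  "euc d = PiM {..<d} (\<lambda>_. borel)"

definition dot :: "nat \<Rightarrow> (nat \<Rightarrow> real) \<Rightarrow> (nat \<Rightarrow> real) \<Rightarrow> real" where
  "dot d x t = (\<Sum>k<d. x k * t k)"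

definition symmetric_measure :: "nat \<Rightarrow> (nat \<Rightarrow> real) measure \<Rightarrow> bool" where
  "symmetric_measure d \<rho> \<longleftrightarrow> distr \<rho> (euc d) (\<lambda>t. \<lambda>k\<in>{..<d}. - t k) = \<rho>"

definition full_support :: "nat \<Rightarrow> (nat \<Rightarrow> real) measure \<Rightarrow> bool" where
  "full_support d \<rho> \<longleftrightarrow>
     (\<forall>U. openin (product_topology (\<lambda>_. euclideanreal) {..<d}) U \<and> U \<noteq> {} \<longrightarrow> emeasure \<rho> U > 0)"

text \<open>The integrability condition leaves \<open>\<rho> {0}\<close> unrestricted; \<open>\<sigma>\<close>-finiteness (equivalently, finiteness
  of \<open>\<rho> {0}\<close>) is what makes the product measures of the \<open>\<rho>\<^sub>i\<close> well defined.\<close>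

definition admissible_measure :: "nat \<Rightarrow> (nat \<Rightarrow> real) measure \<Rightarrow> bool" where
  "admissible_measure d \<rho> \<longleftrightarrow>
     sets \<rho> = sets (euc d) \<and> sigma_finite_measure \<rho> \<and>
     symmetric_measure d \<rho> \<and> full_support d \<rho> \<and>
     (\<integral>\<^sup>+ t. ennreal (min 1 (dot d t t)) \<partial>\<rho>) < \<infinity>"

definition psi :: "nat \<Rightarrow> (nat \<Rightarrow> real) measure \<Rightarrow> (nat \<Rightarrow> real) \<Rightarrow> real" where
  "psi d \<rho> x = (\<integral>t. 1 - cos (dot d x t) \<partial>\<rho>)"

definition char_vec :: "'w measure \<Rightarrow> nat \<Rightarrow> ('w \<Rightarrow> nat \<Rightarrow> real) \<Rightarrow> (nat \<Rightarrow> real) \<Rightarrow> complex" where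
  "char_vec M d X t = (\<integral>\<omega>. iexp (dot d (X \<omega>) t) \<partial>M)"

definition cdf_vec :: "'w measure \<Rightarrow> nat \<Rightarrow> ('w \<Rightarrow> nat \<Rightarrow> real) \<Rightarrow> (nat \<Rightarrow> real) \<Rightarrow> real" where
  "cdf_vec M d X a = measure M {\<omega> \<in> space M. \<forall>k<d. X \<omega> k \<le> a k}"

definition product_law ::
  "'w measure \<Rightarrow> nat \<Rightarrow> (nat \<Rightarrow> nat) \<Rightarrow> (nat \<Rightarrow> 'w \<Rightarrow> nat \<Rightarrow> real) \<Rightarrow> (nat \<Rightarrow> nat \<Rightarrow> real) measure" where
  "product_law M n d X = PiM {1..n} (\<lambda>i. distr M (euc (d i)) (X i))"

definition independent_copy ::
  "'w measure \<Rightarrow> nat \<Rightarrow> (nat \<Rightarrow> nat) \<Rightarrow> (nat \<Rightarrow> 'w \<Rightarrow> nat \<Rightarrow> real) \<Rightarrow> (nat \<Rightarrow> 'w \<Rightarrow> nat \<Rightarrow> real) \<Rightarrow> bool" where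
  "independent_copy M n d X X' \<longleftrightarrow>
     (let E = PiM {1..n} (\<lambda>i. euc (d i));
          V = (\<lambda>\<omega>. \<lambda>i\<in>{1..n}. X i \<omega>);
          V' = (\<lambda>\<omega>. \<lambda>i\<in>{1..n}. X' i \<omega>)
      in prob_space.indep_var M E V E V' \<and> distr M E V' = distr M E V)"

definition Psi ::
  "'w measure \<Rightarrow> nat \<Rightarrow> (nat \<Rightarrow> real) measure \<Rightarrow> ('w \<Rightarrow> nat \<Rightarrow> real) \<Rightarrow> ('w \<Rightarrow> nat \<Rightarrow> real) \<Rightarrow>
   (nat \<Rightarrow> real) \<Rightarrow> (nat \<Rightarrow> real) \<Rightarrow> real" where
  "Psi M d \<rho> X X' x y =
     - psi d \<rho> (x - y) + (\<integral>\<omega>. psi d \<rho> (X \<omega> - y) \<partial>M)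
     + (\<integral>\<omega>. psi d \<rho> (x - X' \<omega>) \<partial>M) - (\<integral>\<omega>. psi d \<rho> (X \<omega> - X' \<omega>) \<partial>M)"

definition centered_gaussian :: "'w measure \<Rightarrow> ('w \<Rightarrow> real) \<Rightarrow> bool" where
  "centered_gaussian M Z \<longleftrightarrow>
     Z \<in> borel_measurable M \<and>
     ((AE \<omega> in M. Z \<omega> = 0) \<or> (\<exists>\<sigma>>0. distributed M lborel Z (\<lambda>z. ennreal (normal_density 0 \<sigma> z))))"

definition centered_gaussian_family :: "'w measure \<Rightarrow> 'a set \<Rightarrow> ('a \<Rightarrow> 'w \<Rightarrow> real) \<Rightarrow> bool" where
  "centered_gaussian_family M T Z \<longleftrightarrow>
     (\<forall>A c. finite A \<and> A \<subseteq> T \<longrightarrow> centered_gaussian M (\<lambda>\<omega>. \<Sum>t\<in>A. c t * Z t \<omega>))"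

definition brownian_sheet :: "'w measure \<Rightarrow> nat \<Rightarrow> ((nat \<Rightarrow> real) \<Rightarrow> 'w \<Rightarrow> real) \<Rightarrow> bool" where
  "brownian_sheet M n W \<longleftrightarrow>
     (let T = {1..n} \<rightarrow>\<^sub>E {0..1} in
       centered_gaussian_family M T W \<and>
       (\<forall>u\<in>T. \<forall>v\<in>T. (\<integral>\<omega>. W u \<omega> * W v \<omega> \<partial>M) = (\<Prod>i=1..n. min (u i) (v i))))"

definition L2 :: "'a measure \<Rightarrow> ('a \<Rightarrow> complex) set" where
  "L2 P = {f \<in> borel_measurable P. integrable P (\<lambda>x. (cmod (f x))\<^sup>2)}"

definition L2_norm :: "'a measure \<Rightarrow> ('a \<Rightarrow> complex) \<Rightarrow> real" where
  "L2_norm P f = sqrt (\<integral>x. (cmod (f x))\<^sup>2 \<partial>P)"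

definition wiener_integral :: "'w measure \<Rightarrow> 'a measure \<Rightarrow> (('a \<Rightarrow> complex) \<Rightarrow> 'w \<Rightarrow> complex) \<Rightarrow> bool" where
  "wiener_integral M P I \<longleftrightarrow>
     (\<forall>f\<in>L2 P. I f \<in> borel_measurable M) \<and>
     (\<forall>f\<in>L2 P. \<forall>g\<in>L2 P. \<forall>a b. AE \<omega> in M. I (\<lambda>x. a * f x + b * g x) \<omega> = a * I f \<omega> + b * I g \<omega>) \<and>
     (let R = {g :: 'a \<Rightarrow> real. (\<lambda>x. complex_of_real (g x)) \<in> L2 P} in
       (\<forall>g\<in>R. AE \<omega> in M. I (\<lambda>x. complex_of_real (g x)) \<omega> \<in> \<real>) \<and>
       centered_gaussian_family M R (\<lambda>g \<omega>. Re (I (\<lambda>x. complex_of_real (g x)) \<omega>))) \<and>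
     (\<forall>f\<in>L2 P. \<forall>g\<in>L2 P. (\<integral>\<omega>. I f \<omega> * I g \<omega> \<partial>M) = (\<integral>x. f x * g x \<partial>P))"

text \<open>\<open>I\<close> is the integral with respect to \<open>W \<circ> F\<^sub>X\<close>. In the case of real-valued \<open>X\<^sub>i\<close>
  it assigns \<open>W (F\<^sub>X a)\<close> to the orthant \<open>{x. x \<le> a}\<close>. If some \<open>d i > 1\<close>, this cannot be required: the
  covariance of \<open>W (F\<^sub>X a)\<close> and \<open>W (F\<^sub>X b)\<close> is the product of the \<open>min (F\<^sub>i (a i)) (F\<^sub>i (b i))\<close>, whereas
  the isometry forces the covariance to be the product of the \<open>F\<^sub>i (min (a i) (b i))\<close> (componentwise
  minimum), and these differ in general. Then only the law of the integral is prescribed.\<close>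

definition sheet_integral ::
  "'w measure \<Rightarrow> nat \<Rightarrow> (nat \<Rightarrow> nat) \<Rightarrow> (nat \<Rightarrow> 'w \<Rightarrow> nat \<Rightarrow> real) \<Rightarrow> ((nat \<Rightarrow> real) \<Rightarrow> 'w \<Rightarrow> real) \<Rightarrow>
   (((nat \<Rightarrow> nat \<Rightarrow> real) \<Rightarrow> complex) \<Rightarrow> 'w \<Rightarrow> complex) \<Rightarrow> bool" where
  "sheet_integral M n d X W I \<longleftrightarrow>
     wiener_integral M (product_law M n d X) I \<and>
     ((\<forall>i\<in>{1..n}. d i = 1) \<longrightarrow>
       (\<forall>a. AE \<omega> in M. I (indicator {x. \<forall>i\<in>{1..n}. \<forall>k<d i. x i k \<le> a i k}) \<omega>
          = complex_of_real (W (\<lambda>i\<in>{1..n}. cdf_vec M (d i) (X i) (a i)) \<omega>)))"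

text \<open>The projective tensor product \<open>L\<^sup>2(P) \<otimes>\<^sub>\<pi> L\<^sup>2(P)\<close> (completed): its elements are the absolutely
  convergent series of elementary tensors, and the norm is the infimum over all such
  representations. It embeds injectively into \<open>L\<^sup>2(P \<otimes> P)\<close>, and its elements are regarded as kernels
  modulo null sets. Absolute convergence of the series implies convergence of the kernels almost everywhere.\<close>

definition tensor_series ::
  "'a measure \<Rightarrow> (nat \<Rightarrow> 'a \<Rightarrow> complex) \<Rightarrow> (nat \<Rightarrow> 'a \<Rightarrow> complex) \<Rightarrow> ('a \<times> 'a \<Rightarrow> complex) \<Rightarrow> bool" where
  "tensor_series P g h K \<longleftrightarrow>
     (\<forall>k. g k \<in> L2 P \<and> h k \<in> L2 P) \<and>
     summable (\<lambda>k. L2_norm P (g k) * L2_norm P (h k)) \<and>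
     (AE (x, y) in P \<Otimes>\<^sub>M P. (\<lambda>k. g k x * h k y) sums K (x, y))"

definition proj_tensor :: "'a measure \<Rightarrow> ('a \<times> 'a \<Rightarrow> complex) set" where
  "proj_tensor P = {K \<in> borel_measurable (P \<Otimes>\<^sub>M P). \<exists>g h. tensor_series P g h K}"

definition proj_norm :: "'a measure \<Rightarrow> ('a \<times> 'a \<Rightarrow> complex) \<Rightarrow> real" where
  "proj_norm P K = Inf {(\<Sum>k. L2_norm P (g k) * L2_norm P (h k)) | g h. tensor_series P g h K}"

text \<open>\<open>J\<close> is the continuous linear extension to the projective tensor product, with values in
  \<open>L\<^sup>1(M)\<close>, of the map sending \<open>g \<otimes> h\<close> to \<open>I g \<cdot> I h\<close>; this determines \<open>J\<close> up to null sets.\<close>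

definition double_integral ::
  "'w measure \<Rightarrow> 'a measure \<Rightarrow> (('a \<Rightarrow> complex) \<Rightarrow> 'w \<Rightarrow> complex) \<Rightarrow>
   (('a \<times> 'a \<Rightarrow> complex) \<Rightarrow> 'w \<Rightarrow> complex) \<Rightarrow> bool" where
  "double_integral M P I J \<longleftrightarrow>
     (\<forall>K\<in>proj_tensor P. integrable M (J K)) \<and>
     (\<forall>K\<in>proj_tensor P. \<forall>L\<in>proj_tensor P. \<forall>a b.
        AE \<omega> in M. J (\<lambda>z. a * K z + b * L z) \<omega> = a * J K \<omega> + b * J L \<omega>) \<and>
     (\<exists>C. \<forall>K\<in>proj_tensor P. (\<integral>\<omega>. cmod (J K \<omega>) \<partial>M) \<le> C * proj_norm P K) \<and>
     (\<forall>g\<in>L2 P. \<forall>h\<in>L2 P. AE \<omega> in M. J (\<lambda>(x, y). g x * h y) \<omega> = I g \<omega> * I h \<omega>)"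

definition G_version ::
  "'w measure \<Rightarrow> (nat \<Rightarrow> nat) \<Rightarrow> (nat \<Rightarrow> (nat \<Rightarrow> real) measure) \<Rightarrow> (nat \<Rightarrow> 'w \<Rightarrow> nat \<Rightarrow> real) \<Rightarrow> nat set \<Rightarrow>
   (((nat \<Rightarrow> nat \<Rightarrow> real) \<Rightarrow> complex) \<Rightarrow> 'w \<Rightarrow> complex) \<Rightarrow>
   ((nat \<Rightarrow> nat \<Rightarrow> real) \<Rightarrow> 'w \<Rightarrow> complex) \<Rightarrow> bool" where
  "G_version M d \<rho> X S I G \<longleftrightarrow>
     (\<lambda>(t, \<omega>). G t \<omega>) \<in> borel_measurable (PiM S \<rho> \<Otimes>\<^sub>M M) \<and>
     (\<forall>t\<in>space (PiM S \<rho>). AE \<omega> in M.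
        G t \<omega> = I (\<lambda>x. \<Prod>i\<in>S. iexp (dot (d i) (x i) (t i)) - char_vec M (d i) (X i) (t i)) \<omega>)"

end

theory Submission
  imports Defs
begin

text \<open>Write \<open>e x t\<close> for the product over \<open>i \<in> S\<close> of \<open>exp (\<i> x\<^sub>i \<bullet> t\<^sub>i) - f\<^sub>i t\<^sub>i\<close>. Fubini and the symmetry of the \<open>\<rho>\<^sub>i\<close>
  give \<open>\<integral> e x t * cnj (e y t) d\<rho>\<^sub>S(t) = K (x, y)\<close> for \<^emph>\<open>all\<close> \<open>x\<close> and \<open>y\<close>, so \<open>K\<close> is a Gram kernel in \<open>L\<^sup>2(\<rho>\<^sub>S)\<close>,
  taken as a real Hilbert space of complex-valued functions. The map \<open>x \<mapsto> e x\<close> into it is continuous,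
  so Gram-Schmidt applied to \<open>e q\<close>, with \<open>q\<close> running through a countable dense set, yields an orthonormal
  sequence \<open>a\<^sub>k\<close> for which every \<open>e x\<close> satisfies Parseval's identity. With \<open>u\<^sub>k x = \<langle>e x, a\<^sub>k\<rangle>\<close> this reads
  \<open>K = \<Sum>\<^sub>k u\<^sub>k \<otimes> u\<^sub>k\<close>, and \<open>\<Sum>\<^sub>k \<parallel>u\<^sub>k\<parallel>\<^sup>2\<close> equals the trace \<open>\<integral> K (x, x) dP(x) < \<infinity>\<close>; hence the double integral
  of \<open>K\<close> is \<open>\<Sum>\<^sub>k (I u\<^sub>k)\<^sup>2\<close>. On the other side, the expectation of
  \<open>\<parallel>G\<parallel>\<^sup>2 - 2 (\<Sum>k<n. \<langle>G, a\<^sub>k\<rangle> I u\<^sub>k) + (\<Sum>k<n. (I u\<^sub>k)\<^sup>2)\<close> is a tail of the same trace series. By Bessel's inequality this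
  forces \<open>\<langle>G, a\<^sub>k\<rangle> = I u\<^sub>k\<close> and \<open>\<parallel>G\<parallel>\<^sup>2 = \<Sum>\<^sub>k (I u\<^sub>k)\<^sup>2\<close> almost surely.\<close>

subsection \<open>Orthonormal sequences of square-integrable functions\<close>

definition sq_integrable :: "'t measure \<Rightarrow> ('t \<Rightarrow> 'b::euclidean_space) \<Rightarrow> bool" where
  "sq_integrable \<mu> f \<longleftrightarrow> f \<in> borel_measurable \<mu> \<and> integrable \<mu> (\<lambda>t. (norm (f t))\<^sup>2)"

text \<open>The codomain is left general because both cases occur: real functions on
  \<open>P\<close> and \<open>M\<close>, complex ones on \<open>\<mu>\<close>. For complex functions
  the inner product is the real part of \<open>f * cnj g\<close>, so everything happens in a real
  Hilbert space.\<close>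

definition L2_inner :: "'t measure \<Rightarrow> ('t \<Rightarrow> 'b::euclidean_space) \<Rightarrow> ('t \<Rightarrow> 'b) \<Rightarrow> real" where
  "L2_inner \<mu> f g = (\<integral>t. f t \<bullet> g t \<partial>\<mu>)"

text \<open>Weak AM-GM: the constant 1 instead of 1/2 suffices, since the bound only ever serves as
  an integrable majorant.\<close>

lemma abs_inner_le_squares:
  fixes x y :: "'b::real_inner"
  shows "\<bar>x \<bullet> y\<bar> \<le> (norm x)\<^sup>2 + (norm y)\<^sup>2"
proof -
  have "0 \<le> (norm x - norm y)\<^sup>2" by simp
  moreover have "0 \<le> norm x * norm y" by simp
  ultimately show ?thesis
    using Cauchy_Schwarz_ineq2[of x y] unfolding power2_diff by linarith
qed

lemma integrable_inner_sq_integrable: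
  assumes "sq_integrable \<mu> f" "sq_integrable \<mu> g"
  shows "integrable \<mu> (\<lambda>t. f t \<bullet> g t)"
proof (rule Bochner_Integration.integrable_bound)
  show "integrable \<mu> (\<lambda>t. (norm (f t))\<^sup>2 + (norm (g t))\<^sup>2)"
    using assms by (auto simp: sq_integrable_def)
  show "(\<lambda>t. f t \<bullet> g t) \<in> borel_measurable \<mu>"
    using assms by (auto simp: sq_integrable_def)
  show "AE t in \<mu>. norm (f t \<bullet> g t) \<le> norm ((norm (f t))\<^sup>2 + (norm (g t))\<^sup>2)"
    by (auto intro: abs_inner_le_squares)
qed

lemma L2_inner_commute: "L2_inner \<mu> f g = L2_inner \<mu> g f"
  by (simp add: L2_inner_def inner_commute)

lemma L2_inner_self: "L2_inner \<mu> f f = (\<integral>t. (norm (f t))\<^sup>2 \<partial>\<mu>)"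
  by (simp add: L2_inner_def power2_norm_eq_inner)

lemma L2_inner_self_nonneg: "0 \<le> L2_inner \<mu> f f"
  by (simp add: L2_inner_self)

lemma L2_inner_zero [simp]: "L2_inner \<mu> f (\<lambda>_. 0) = 0" "L2_inner \<mu> (\<lambda>_. 0) f = 0"
  by (simp_all add: L2_inner_def)

lemma sq_integrable_scaleR: "sq_integrable \<mu> f \<Longrightarrow> sq_integrable \<mu> (\<lambda>t. c *\<^sub>R f t)"
  by (auto simp: sq_integrable_def power_mult_distrib)

lemma sq_integrable_zero: "sq_integrable \<mu> (\<lambda>_. 0)"
  by (auto simp: sq_integrable_def)

lemma sq_integrable_add:
  assumes "sq_integrable \<mu> f" "sq_integrable \<mu> g"
  shows "sq_integrable \<mu> (\<lambda>t. f t + g t)"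
proof -
  have "(norm (f t + g t))\<^sup>2 = (norm (f t))\<^sup>2 + 2 * (f t \<bullet> g t) + (norm (g t))\<^sup>2" for t
    by (simp add: power2_norm_eq_inner inner_add inner_commute)
  moreover have "integrable \<mu> (\<lambda>t. (norm (f t))\<^sup>2 + 2 * (f t \<bullet> g t) + (norm (g t))\<^sup>2)"
    using assms integrable_inner_sq_integrable[OF assms] by (auto simp: sq_integrable_def)
  ultimately show ?thesis
    using assms by (auto simp: sq_integrable_def)
qed

lemma sq_integrable_diff:
  assumes "sq_integrable \<mu> f" "sq_integrable \<mu> g"
  shows "sq_integrable \<mu> (\<lambda>t. f t - g t)"
  using sq_integrable_add[OF assms(1) sq_integrable_scaleR[OF assms(2), of "-1"]] by simp

lemma sq_integrable_sum:
  assumes "\<And>k. k \<in> A \<Longrightarrow> sq_integrable \<mu> (f k)"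
  shows "sq_integrable \<mu> (\<lambda>t. \<Sum>k\<in>A. f k t)"
  using assms by (induction A rule: infinite_finite_induct) (auto intro: sq_integrable_add sq_integrable_zero)

lemma L2_inner_add_left:
  assumes "sq_integrable \<mu> f" "sq_integrable \<mu> g" "sq_integrable \<mu> h"
  shows "L2_inner \<mu> (\<lambda>t. f t + g t) h = L2_inner \<mu> f h + L2_inner \<mu> g h"
  using assms by (simp add: L2_inner_def inner_add_left integrable_inner_sq_integrable)

lemma L2_inner_diff_left:
  assumes "sq_integrable \<mu> f" "sq_integrable \<mu> g" "sq_integrable \<mu> h"
  shows "L2_inner \<mu> (\<lambda>t. f t - g t) h = L2_inner \<mu> f h - L2_inner \<mu> g h"
  using assms by (simp add: L2_inner_def inner_diff_left integrable_inner_sq_integrable)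

lemma L2_inner_scaleR_left: "L2_inner \<mu> (\<lambda>t. c *\<^sub>R f t) h = c * L2_inner \<mu> f h"
  by (simp add: L2_inner_def)

lemma L2_inner_sum_left:
  assumes "\<And>k. k \<in> A \<Longrightarrow> sq_integrable \<mu> (f k)" "sq_integrable \<mu> h"
  shows "L2_inner \<mu> (\<lambda>t. \<Sum>k\<in>A. f k t) h = (\<Sum>k\<in>A. L2_inner \<mu> (f k) h)"
  unfolding L2_inner_def inner_sum_left
  by (rule Bochner_Integration.integral_sum) (use assms in \<open>auto intro: integrable_inner_sq_integrable\<close>)

lemma L2_inner_sum_scaleR_left:
  assumes "\<And>k. k \<in> A \<Longrightarrow> sq_integrable \<mu> (f k)" "sq_integrable \<mu> h"
  shows "L2_inner \<mu> (\<lambda>t. \<Sum>k\<in>A. c k *\<^sub>R f k t) h = (\<Sum>k\<in>A. c k * L2_inner \<mu> (f k) h)"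
  using L2_inner_sum_left[of A \<mu> "\<lambda>k t. c k *\<^sub>R f k t" h] assms by (simp add: sq_integrable_scaleR L2_inner_scaleR_left)

lemma L2_inner_diff_right:
  assumes "sq_integrable \<mu> f" "sq_integrable \<mu> g" "sq_integrable \<mu> h"
  shows "L2_inner \<mu> h (\<lambda>t. f t - g t) = L2_inner \<mu> h f - L2_inner \<mu> h g"
  using L2_inner_diff_left[OF assms] by (simp add: L2_inner_commute)

lemma L2_inner_add_right:
  assumes "sq_integrable \<mu> f" "sq_integrable \<mu> g" "sq_integrable \<mu> h"
  shows "L2_inner \<mu> h (\<lambda>t. f t + g t) = L2_inner \<mu> h f + L2_inner \<mu> h g"
  using L2_inner_add_left[OF assms] by (simp add: L2_inner_commute)

text \<open>Zero functions are admitted, because \<open>gram_schmidt\<close> does not discard linearly dependent functions.\<close>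

definition ortho_seq :: "'t measure \<Rightarrow> nat set \<Rightarrow> (nat \<Rightarrow> 't \<Rightarrow> 'b::euclidean_space) \<Rightarrow> bool" where
  "ortho_seq \<mu> A a \<longleftrightarrow>
     (\<forall>k\<in>A. sq_integrable \<mu> (a k)) \<and> (\<forall>j\<in>A. \<forall>k\<in>A. j \<noteq> k \<longrightarrow> L2_inner \<mu> (a j) (a k) = 0) \<and>
     (\<forall>k\<in>A. L2_inner \<mu> (a k) (a k) = 1 \<or> a k = (\<lambda>_. 0))"

section \<open>Bessel's inequality and its defect\<close>

definition residual ::
  "'t measure \<Rightarrow> nat \<Rightarrow> (nat \<Rightarrow> 't \<Rightarrow> 'b::euclidean_space) \<Rightarrow> ('t \<Rightarrow> 'b) \<Rightarrow> 't \<Rightarrow> 'b" where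
  "residual \<mu> n a f = (\<lambda>t. f t - (\<Sum>k<n. L2_inner \<mu> f (a k) *\<^sub>R a k t))"

text \<open>For an \<open>ortho_seq\<close> this is the squared distance from \<open>f\<close> to
  the span of the first \<open>n\<close> functions. Defining it by the formula makes it a quadratic
  form in \<open>f\<close> and decreasing in \<open>n\<close> without any hypothesis on
  \<open>a\<close>.\<close>

definition defect ::
  "'t measure \<Rightarrow> nat \<Rightarrow> (nat \<Rightarrow> 't \<Rightarrow> 'b::euclidean_space) \<Rightarrow> ('t \<Rightarrow> 'b) \<Rightarrow> real" where
  "defect \<mu> n a f = L2_inner \<mu> f f - (\<Sum>k<n. (L2_inner \<mu> f (a k))\<^sup>2)"

lemma sq_integrable_residual:
  assumes "ortho_seq \<mu> {..<n} a" "sq_integrable \<mu> f"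
  shows "sq_integrable \<mu> (residual \<mu> n a f)"
  unfolding residual_def
  by (intro sq_integrable_diff sq_integrable_sum sq_integrable_scaleR) (use assms in \<open>auto simp: ortho_seq_def\<close>)

lemma L2_inner_residual_left:
  assumes a: "ortho_seq \<mu> {..<n} a" and f: "sq_integrable \<mu> f" and h: "sq_integrable \<mu> h"
  shows "L2_inner \<mu> (residual \<mu> n a f) h = L2_inner \<mu> f h - (\<Sum>k<n. L2_inner \<mu> f (a k) * L2_inner \<mu> (a k) h)"
proof -
  have sq: "\<And>k. k \<in> {..<n} \<Longrightarrow> sq_integrable \<mu> (a k)" using a by (auto simp: ortho_seq_def)
  have "sq_integrable \<mu> (\<lambda>t. \<Sum>k<n. L2_inner \<mu> f (a k) *\<^sub>R a k t)"
    using sq by (intro sq_integrable_sum sq_integrable_scaleR)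
  then show ?thesis
    unfolding residual_def
    by (simp only: L2_inner_diff_left[OF f _ h] L2_inner_sum_scaleR_left[OF sq h])
qed

lemma L2_inner_residual:
  assumes a: "ortho_seq \<mu> {..<n} a" and f: "sq_integrable \<mu> f" and j: "j < n"
  shows "L2_inner \<mu> (residual \<mu> n a f) (a j) = 0"
proof -
  have sq: "\<And>k. k < n \<Longrightarrow> sq_integrable \<mu> (a k)" using a by (auto simp: ortho_seq_def)
  have "L2_inner \<mu> (residual \<mu> n a f) (a j) = L2_inner \<mu> f (a j) - (\<Sum>k<n. L2_inner \<mu> f (a k) * L2_inner \<mu> (a k) (a j))"
    by (rule L2_inner_residual_left[OF a f sq[OF j]])
  also have "(\<Sum>k<n. L2_inner \<mu> f (a k) * L2_inner \<mu> (a k) (a j)) = (\<Sum>k<n. if k = j then L2_inner \<mu> f (a j) * L2_inner \<mu> (a j) (a j) else 0)"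
    by (rule sum.cong) (use a j in \<open>auto simp: ortho_seq_def\<close>)
  \<comment> \<open>Either \<open>a j\<close> has norm 1, or it is the zero function and both sides
    vanish.\<close>
  also have "\<dots> = L2_inner \<mu> f (a j)"
    using a j by (auto simp: ortho_seq_def)
  finally show ?thesis by simp
qed

text \<open>The residual is orthogonal to every \<open>a k\<close> with \<open>k < n\<close>, so
  pairing it with itself or with \<open>f\<close> gives the same value.\<close>

lemma L2_inner_residual_self:
  assumes a: "ortho_seq \<mu> {..<n} a" and f: "sq_integrable \<mu> f"
  shows "L2_inner \<mu> f (residual \<mu> n a f) = defect \<mu> n a f"
    and "L2_inner \<mu> (residual \<mu> n a f) (residual \<mu> n a f) = defect \<mu> n a f"
proof -
  note * = L2_inner_residual_left[OF a f]
  show 1: "L2_inner \<mu> f (residual \<mu> n a f) = defect \<mu> n a f"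
    using *[OF f] by (simp add: L2_inner_commute defect_def power2_eq_square)
  have "(\<Sum>k<n. L2_inner \<mu> f (a k) * L2_inner \<mu> (a k) (residual \<mu> n a f)) = 0"
    by (rule sum.neutral) (use L2_inner_residual[OF a f] in \<open>auto simp: L2_inner_commute\<close>)
  then show "L2_inner \<mu> (residual \<mu> n a f) (residual \<mu> n a f) = defect \<mu> n a f"
    using *[OF sq_integrable_residual[OF a f]] 1 by simp
qed

lemma defect_nonneg:
  assumes "ortho_seq \<mu> {..<n} a" "sq_integrable \<mu> f"
  shows "0 \<le> defect \<mu> n a f"
  using L2_inner_residual_self(2)[OF assms] L2_inner_self_nonneg by metis

lemma defect_antimono: "m \<le> n \<Longrightarrow> defect \<mu> n a f \<le> defect \<mu> m a f"
  unfolding defect_def by (intro diff_left_mono sum_mono2) auto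

lemma defect_le: "defect \<mu> n a f \<le> L2_inner \<mu> f f"
  unfolding defect_def by (simp add: sum_nonneg)

lemma defect_add:
  assumes a: "\<And>k. sq_integrable \<mu> (a k)" and "sq_integrable \<mu> f" "sq_integrable \<mu> g"
  shows "defect \<mu> n a (\<lambda>t. f t + g t) =
    defect \<mu> n a f + defect \<mu> n a g + 2 * (L2_inner \<mu> f g - (\<Sum>k<n. L2_inner \<mu> f (a k) * L2_inner \<mu> g (a k)))"
  using assms
  by (simp add: defect_def L2_inner_add_left L2_inner_add_right sq_integrable_add L2_inner_commute[of _ g f] power2_sum sum.distrib
      sum_distrib_left algebra_simps)

lemma defect_uminus: "defect \<mu> n a (\<lambda>t. - f t) = defect \<mu> n a f"
  by (simp add: defect_def L2_inner_def)

text \<open>Parallelogram law for the quadratic form \<open>defect\<close>: the values at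
  \<open>f + g\<close> and \<open>f - g\<close> add up to the right-hand side, and the one at
  \<open>f - g\<close> is nonnegative by Bessel.\<close>

lemma defect_add_le:
  assumes a: "ortho_seq \<mu> UNIV a" and f: "sq_integrable \<mu> f" and g: "sq_integrable \<mu> g"
  shows "defect \<mu> n a (\<lambda>t. f t + g t) \<le> 2 * defect \<mu> n a f + 2 * defect \<mu> n a g"
proof -
  have sq: "\<And>k. sq_integrable \<mu> (a k)" using a by (auto simp: ortho_seq_def)
  have g': "sq_integrable \<mu> (\<lambda>t. - g t)" using sq_integrable_scaleR[OF g, of "-1"] by simp
  have "0 \<le> defect \<mu> n a (\<lambda>t. f t + - g t)"
    by (rule defect_nonneg) (use a sq_integrable_add[OF f g'] in \<open>auto simp: ortho_seq_def\<close>)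
  moreover have "L2_inner \<mu> f (\<lambda>t. - g t) = - L2_inner \<mu> f g" "\<And>k. L2_inner \<mu> (\<lambda>t. - g t) (a k) = - L2_inner \<mu> g (a k)"
    by (simp_all add: L2_inner_def)
  ultimately show ?thesis
    using defect_add[OF sq f g, of n] defect_add[OF sq f g', of n]
    by (simp add: defect_uminus sum_negf)
qed

text \<open>If the residual \<open>r\<close> is null, then \<open>1 / 0 = 0\<close> makes the new function zero everywhere.\<close>

function gram_schmidt :: "'t measure \<Rightarrow> (nat \<Rightarrow> 't \<Rightarrow> 'b::euclidean_space) \<Rightarrow> nat \<Rightarrow> 't \<Rightarrow> 'b" where
  "gram_schmidt \<mu> f n =
     (let r = (\<lambda>t. f n t - (\<Sum>k<n. L2_inner \<mu> (f n) (gram_schmidt \<mu> f k) *\<^sub>R gram_schmidt \<mu> f k t))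
      in (\<lambda>t. (1 / sqrt (L2_inner \<mu> r r)) *\<^sub>R r t))"
  by pat_completeness auto
termination by (relation "Wellfounded.measure (\<lambda>(_, _, n). n)") auto

declare gram_schmidt.simps [simp del]

lemma gram_schmidt_residual:
  "gram_schmidt \<mu> f n =
     (let r = residual \<mu> n (gram_schmidt \<mu> f) (f n) in (\<lambda>t. (1 / sqrt (L2_inner \<mu> r r)) *\<^sub>R r t))"
  by (subst gram_schmidt.simps) (simp add: residual_def)

lemma ortho_seq_gram_schmidt:
  assumes f: "\<And>n. sq_integrable \<mu> (f n)"
  shows "ortho_seq \<mu> {..<n} (gram_schmidt \<mu> f)"
proof (induction n)
  case 0
  show ?case by (simp add: ortho_seq_def)
next
  case (Suc n)
  let ?a = "gram_schmidt \<mu> f"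
  define r where "r = residual \<mu> n ?a (f n)"
  have an: "?a n = (\<lambda>t. (1 / sqrt (L2_inner \<mu> r r)) *\<^sub>R r t)"
    by (subst gram_schmidt_residual) (simp add: r_def Let_def)
  have sq: "sq_integrable \<mu> (?a n)"
    unfolding an r_def by (intro sq_integrable_scaleR sq_integrable_residual Suc f)
  have 0: "L2_inner \<mu> (?a n) (?a j) = 0" if "j < n" for j
    using L2_inner_residual[OF Suc f that, of n] by (simp add: an L2_inner_scaleR_left r_def)
  have 1: "L2_inner \<mu> (?a n) (?a n) = 1 \<or> ?a n = (\<lambda>_. 0)"
  proof (cases "L2_inner \<mu> r r = 0")
    case False
    then have pos: "L2_inner \<mu> r r > 0" using L2_inner_self_nonneg[of \<mu> r] by linarith
    have "L2_inner \<mu> (?a n) (?a n) = (1 / sqrt (L2_inner \<mu> r r)) * ((1 / sqrt (L2_inner \<mu> r r)) * L2_inner \<mu> r r)"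
      unfolding an by (simp add: L2_inner_def)
    then show ?thesis using pos by (simp add: field_simps)
  qed (simp add: an)
  show ?case
    using Suc sq 0 1 unfolding ortho_seq_def lessThan_Suc by (auto simp: L2_inner_commute)
qed

lemma ortho_seq_gram_schmidt_UNIV:
  assumes f: "\<And>n. sq_integrable \<mu> (f n)"
  shows "ortho_seq \<mu> UNIV (gram_schmidt \<mu> f)"
  unfolding ortho_seq_def
proof (intro conjI ballI impI)
  fix j k :: nat
  have o: "ortho_seq \<mu> {..<Suc (max j k)} (gram_schmidt \<mu> f)" by (rule ortho_seq_gram_schmidt[OF f])
  have m: "j \<in> {..<Suc (max j k)}" "k \<in> {..<Suc (max j k)}" by auto
  show "sq_integrable \<mu> (gram_schmidt \<mu> f k)"
    "L2_inner \<mu> (gram_schmidt \<mu> f k) (gram_schmidt \<mu> f k) = 1 \<or> gram_schmidt \<mu> f k = (\<lambda>_. 0)"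
    using o m(2) unfolding ortho_seq_def by blast+
  show "L2_inner \<mu> (gram_schmidt \<mu> f j) (gram_schmidt \<mu> f k) = 0" if "j \<noteq> k"
    using o m that unfolding ortho_seq_def by blast
qed

text \<open>The coefficient of \<open>f j\<close> along the \<open>j\<close>-th new function has as
  its square the squared norm of the residual, which is exactly the defect left at stage
  \<open>j\<close>. So the defect is 0 at stage \<open>Suc j\<close> and stays there. A null
  residual causes no exception, as both quantities are then 0.\<close>

lemma defect_gram_schmidt:
  assumes f: "\<And>n. sq_integrable \<mu> (f n)" and "j < n"
  shows "defect \<mu> n (gram_schmidt \<mu> f) (f j) = 0"
proof -
  let ?a = "gram_schmidt \<mu> f"
  have o: "\<And>n. ortho_seq \<mu> {..<n} ?a" by (rule ortho_seq_gram_schmidt) (rule f)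
  define r where "r = residual \<mu> j ?a (f j)"
  have aj: "?a j = (\<lambda>t. (1 / sqrt (L2_inner \<mu> r r)) *\<^sub>R r t)"
    by (subst gram_schmidt_residual) (simp add: r_def Let_def)
  have "L2_inner \<mu> (f j) (?a j) = L2_inner \<mu> (f j) r / sqrt (L2_inner \<mu> r r)"
    unfolding aj by (simp add: L2_inner_def)
  also have "L2_inner \<mu> (f j) r = L2_inner \<mu> r r"
    using L2_inner_residual_self[OF o f] by (simp add: r_def)
  finally have "(L2_inner \<mu> (f j) (?a j))\<^sup>2 = L2_inner \<mu> r r"
    using L2_inner_self_nonneg[of \<mu> r] by (simp add: real_div_sqrt)
  moreover have "defect \<mu> j ?a (f j) = L2_inner \<mu> r r"
    using L2_inner_residual_self(2)[OF o f] by (simp add: r_def)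
  ultimately have "defect \<mu> (Suc j) ?a (f j) = 0"
    by (simp add: defect_def)
  then show ?thesis
    using defect_antimono[of "Suc j" n \<mu> ?a "f j"] defect_nonneg[OF o[of n] f[of j]] assms(2) by simp
qed

text \<open>Split \<open>g\<close> as \<open>(g - f j) + f j\<close>. The second part has defect 0
  from stage \<open>Suc j\<close> on, and the defect of the first never exceeds its squared
  norm.\<close>

lemma defect_tendsto_0:
  assumes f: "\<And>n. sq_integrable \<mu> (f n)" and g: "sq_integrable \<mu> g"
    and dense: "\<And>\<epsilon>. \<epsilon> > 0 \<Longrightarrow> \<exists>j. L2_inner \<mu> (\<lambda>t. g t - f j t) (\<lambda>t. g t - f j t) < \<epsilon>"
  shows "(\<lambda>n. defect \<mu> n (gram_schmidt \<mu> f) g) \<longlonglongrightarrow> 0"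
proof (rule LIMSEQ_I)
  fix \<epsilon> :: real assume "\<epsilon> > 0"
  let ?a = "gram_schmidt \<mu> f"
  \<comment> \<open>Half of \<epsilon> compensates for the factor 2 in
    \<open>defect_add_le\<close>.\<close>
  obtain j where j: "L2_inner \<mu> (\<lambda>t. g t - f j t) (\<lambda>t. g t - f j t) < \<epsilon> / 2"
    using dense[of "\<epsilon> / 2"] \<open>\<epsilon> > 0\<close> by auto
  have "norm (defect \<mu> n ?a g - 0) < \<epsilon>" if "n \<ge> Suc j" for n
  proof -
    have "defect \<mu> n ?a g = defect \<mu> n ?a (\<lambda>t. (g t - f j t) + f j t)" by simp
    also have "\<dots> \<le> 2 * defect \<mu> n ?a (\<lambda>t. g t - f j t) + 2 * defect \<mu> n ?a (f j)"
      by (intro defect_add_le ortho_seq_gram_schmidt_UNIV f sq_integrable_diff g)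
    also have "defect \<mu> n ?a (f j) = 0"
      using that by (intro defect_gram_schmidt f) simp
    also have "defect \<mu> n ?a (\<lambda>t. g t - f j t) \<le> L2_inner \<mu> (\<lambda>t. g t - f j t) (\<lambda>t. g t - f j t)"
      by (rule defect_le)
    finally show ?thesis
      using j defect_nonneg[OF ortho_seq_gram_schmidt[OF f] g, of n] by simp
  qed
  then show "\<exists>no. \<forall>n\<ge>no. norm (defect \<mu> n ?a g - 0) < \<epsilon>" by blast
qed

text \<open>Polarization: the partial sums differ from the inner product by half of
  \<open>defect (f + g) - defect f - defect g\<close>, and all three defects tend to 0.\<close>

lemma L2_inner_parseval:
  assumes a: "ortho_seq \<mu> UNIV a" and f: "sq_integrable \<mu> f" and g: "sq_integrable \<mu> g"
    and F: "(\<lambda>n. defect \<mu> n a f) \<longlonglongrightarrow> 0" and G: "(\<lambda>n. defect \<mu> n a g) \<longlonglongrightarrow> 0"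
  shows "(\<lambda>k. L2_inner \<mu> f (a k) * L2_inner \<mu> g (a k)) sums L2_inner \<mu> f g"
proof -
  have sq: "\<And>k. sq_integrable \<mu> (a k)" using a by (auto simp: ortho_seq_def)
  have "(\<lambda>n. defect \<mu> n a (\<lambda>t. f t + g t)) \<longlonglongrightarrow> 0"
  proof (rule tendsto_sandwich)
    show "\<forall>\<^sub>F n in sequentially. 0 \<le> defect \<mu> n a (\<lambda>t. f t + g t)"
      by (intro always_eventually allI defect_nonneg sq_integrable_add f g) (use a in \<open>auto simp: ortho_seq_def\<close>)
    show "\<forall>\<^sub>F n in sequentially. defect \<mu> n a (\<lambda>t. f t + g t) \<le> 2 * defect \<mu> n a f + 2 * defect \<mu> n a g"
      by (intro always_eventually allI defect_add_le a f g)
    show "(\<lambda>n. 2 * defect \<mu> n a f + 2 * defect \<mu> n a g) \<longlonglongrightarrow> 0"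
      using tendsto_add[OF tendsto_mult_right[OF F, of 2] tendsto_mult_right[OF G, of 2]]
      by (simp add: mult.commute)
  qed simp
  from tendsto_diff[OF tendsto_diff[OF this F] G]
  have "(\<lambda>n. 2 * (L2_inner \<mu> f g - (\<Sum>k<n. L2_inner \<mu> f (a k) * L2_inner \<mu> g (a k)))) \<longlonglongrightarrow> 0"
    unfolding defect_add[OF sq f g] by (simp add: algebra_simps)
  from tendsto_diff[OF tendsto_const[of "L2_inner \<mu> f g"] tendsto_mult_left[OF this, of "1/2"]]
  show ?thesis by (simp add: sums_def diff_divide_distrib)
qed

subsection \<open>Wiener integrals and projective tensor products\<close>

text \<open>The degenerate Gaussian has no density and is treated separately; otherwise this is the
  second moment of the normal density.\<close>

lemma centered_gaussian_integrable_square: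
  assumes "centered_gaussian M Z"
  shows "integrable M (\<lambda>\<omega>. (Z \<omega>)\<^sup>2)"
proof -
  have Z: "Z \<in> borel_measurable M" using assms by (simp add: centered_gaussian_def)
  consider "AE \<omega> in M. Z \<omega> = 0"
    | \<sigma> where "\<sigma> > 0" "distributed M lborel Z (\<lambda>z. ennreal (normal_density 0 \<sigma> z))"
    using assms by (auto simp: centered_gaussian_def)
  then show ?thesis
  proof cases
    case 1
    then have "integrable M (\<lambda>\<omega>. (Z \<omega>)\<^sup>2) \<longleftrightarrow> integrable M (\<lambda>\<omega>. 0 :: real)"
      using Z by (intro integrable_cong_AE) auto
    then show ?thesis by simp
  next
    case 2
    have "integrable lborel (\<lambda>x. normal_density 0 \<sigma> x * x\<^sup>2)"
      using integrable_normal_moment[OF 2(1), of 0 2] by simp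
    then show ?thesis
      using distributed_integrable[OF 2(2), of "\<lambda>x. x\<^sup>2"] by simp
  qed
qed

locale wiener =
  fixes M :: "'w measure" and P :: "'a measure" and I :: "('a \<Rightarrow> complex) \<Rightarrow> 'w \<Rightarrow> complex"
  assumes wiener: "wiener_integral M P I"
begin

text \<open>On real functions \<open>I\<close> is real only almost surely. Taking the real part
  yields a genuinely real-valued process, to which the real \<open>L2_inner\<close> applies.\<close>

definition RI :: "('a \<Rightarrow> real) \<Rightarrow> 'w \<Rightarrow> real" where
  "RI g \<omega> = Re (I (\<lambda>x. complex_of_real (g x)) \<omega>)"

lemma L2_of_real_iff: "(\<lambda>x. complex_of_real (g x)) \<in> L2 P \<longleftrightarrow> sq_integrable P g"
  by (auto simp: L2_def sq_integrable_def borel_measurable_complex_iff)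

lemma L2_Re_Im: "f \<in> L2 P \<longleftrightarrow> sq_integrable P (\<lambda>x. Re (f x)) \<and> sq_integrable P (\<lambda>x. Im (f x))"
proof
  assume f: "f \<in> L2 P"
  then have m: "f \<in> borel_measurable P" and i: "integrable P (\<lambda>x. (cmod (f x))\<^sup>2)" by (auto simp: L2_def)
  show "sq_integrable P (\<lambda>x. Re (f x)) \<and> sq_integrable P (\<lambda>x. Im (f x))"
    unfolding sq_integrable_def using m
    by (auto intro!: Bochner_Integration.integrable_bound[OF i] simp: cmod_power2)
next
  assume *: "sq_integrable P (\<lambda>x. Re (f x)) \<and> sq_integrable P (\<lambda>x. Im (f x))"
  then have "f \<in> borel_measurable P" by (auto simp: sq_integrable_def borel_measurable_complex_iff)
  then show "f \<in> L2 P" using * by (auto simp: L2_def sq_integrable_def cmod_power2)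
qed

lemma I_measurable: "f \<in> L2 P \<Longrightarrow> I f \<in> borel_measurable M"
  using wiener by (auto simp: wiener_integral_def)

lemma I_linear:
  assumes "f \<in> L2 P" "g \<in> L2 P"
  shows "AE \<omega> in M. I (\<lambda>x. a * f x + b * g x) \<omega> = a * I f \<omega> + b * I g \<omega>"
  using wiener assms unfolding wiener_integral_def by blast

lemma RI_measurable: "sq_integrable P g \<Longrightarrow> RI g \<in> borel_measurable M"
  unfolding RI_def using I_measurable[of "\<lambda>x. complex_of_real (g x)"] by (auto simp: L2_of_real_iff)

lemma I_of_real: "sq_integrable P g \<Longrightarrow> AE \<omega> in M. I (\<lambda>x. complex_of_real (g x)) \<omega> = complex_of_real (RI g \<omega>)"
  using wiener unfolding wiener_integral_def Let_def RI_def
  by (auto simp: L2_of_real_iff elim!: eventually_mono elim!: Reals_cases dest!: spec[of _ g])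

lemma sq_integrable_RI:
  assumes "sq_integrable P g"
  shows "sq_integrable M (RI g)"
proof -
  \<comment> \<open>A one-element linear combination with coefficient 1 extracts a single variable
    from the Gaussian family.\<close>
  have "centered_gaussian M (\<lambda>\<omega>. \<Sum>t\<in>{g}. 1 * RI t \<omega>)"
    using wiener assms unfolding wiener_integral_def Let_def centered_gaussian_family_def RI_def
    by (elim conjE allE[of _ "{g}"] allE[of _ "\<lambda>_. 1"]) (auto simp: L2_of_real_iff)
  then have "integrable M (\<lambda>\<omega>. (RI g \<omega>)\<^sup>2)"
    using centered_gaussian_integrable_square by simp
  then show ?thesis
    using RI_measurable[OF assms] by (simp add: sq_integrable_def)
qed

lemma L2_inner_RI:
  assumes f: "sq_integrable P f" and g: "sq_integrable P g"
  shows "L2_inner M (RI f) (RI g) = L2_inner P f g"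
proof -
  let ?f = "\<lambda>x. complex_of_real (f x)" and ?g = "\<lambda>x. complex_of_real (g x)"
  have "(\<integral>\<omega>. I ?f \<omega> * I ?g \<omega> \<partial>M) = (\<integral>x. ?f x * ?g x \<partial>P)"
    using wiener f g by (auto simp: wiener_integral_def L2_of_real_iff[symmetric])
  also have "(\<integral>x. ?f x * ?g x \<partial>P) = complex_of_real (L2_inner P f g)"
    by (simp add: L2_inner_def flip: of_real_mult)
  also have "(\<integral>\<omega>. I ?f \<omega> * I ?g \<omega> \<partial>M) = (\<integral>\<omega>. complex_of_real (RI f \<omega> * RI g \<omega>) \<partial>M)"
  proof (rule integral_cong_AE)
    show "AE \<omega> in M. I ?f \<omega> * I ?g \<omega> = complex_of_real (RI f \<omega> * RI g \<omega>)"
      using I_of_real[OF f] I_of_real[OF g] by eventually_elim simp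
  qed (use f g RI_measurable in \<open>auto intro!: borel_measurable_times I_measurable simp: L2_of_real_iff\<close>)
  finally show ?thesis
    unfolding integral_complex_of_real of_real_eq_iff by (simp add: L2_inner_def)
qed

lemma I_Re_Im:
  assumes "f \<in> L2 P"
  shows "AE \<omega> in M. I f \<omega> = Complex (RI (\<lambda>x. Re (f x)) \<omega>) (RI (\<lambda>x. Im (f x)) \<omega>)"
proof -
  have r: "sq_integrable P (\<lambda>x. Re (f x))" and i: "sq_integrable P (\<lambda>x. Im (f x))" using assms by (auto simp: L2_Re_Im)
  have "AE \<omega> in M. I (\<lambda>x. 1 * complex_of_real (Re (f x)) + \<i> * complex_of_real (Im (f x))) \<omega> =
      1 * I (\<lambda>x. complex_of_real (Re (f x))) \<omega> + \<i> * I (\<lambda>x. complex_of_real (Im (f x))) \<omega>"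
    using I_linear r i by (simp only: L2_of_real_iff)
  moreover have "(\<lambda>x. 1 * complex_of_real (Re (f x)) + \<i> * complex_of_real (Im (f x))) = f"
    by (simp add: fun_eq_iff complex_eq_iff)
  ultimately show ?thesis
    using I_of_real[OF r] I_of_real[OF i] by (auto simp: complex_eq_iff elim: eventually_elim2)
qed

text \<open>The isometry in \<open>wiener_integral\<close> is bilinear, without conjugation. The
  Hermitian norm identity follows by applying it separately to the real and imaginary parts, as the
  squared modulus contains no mixed term.\<close>

lemma integrable_norm_I_square:
  assumes f: "f \<in> L2 P"
  shows "integrable M (\<lambda>\<omega>. (cmod (I f \<omega>))\<^sup>2)"
    and "(\<integral>\<omega>. (cmod (I f \<omega>))\<^sup>2 \<partial>M) = (\<integral>x. (cmod (f x))\<^sup>2 \<partial>P)"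
proof -
  have r: "sq_integrable P (\<lambda>x. Re (f x))" and i: "sq_integrable P (\<lambda>x. Im (f x))" using assms by (auto simp: L2_Re_Im)
  have AE: "AE \<omega> in M. (cmod (I f \<omega>))\<^sup>2 = (RI (\<lambda>x. Re (f x)) \<omega>)\<^sup>2 + (RI (\<lambda>x. Im (f x)) \<omega>)\<^sup>2"
    using I_Re_Im[OF f] by eventually_elim (simp add: cmod_power2)
  have m: "(\<lambda>\<omega>. (cmod (I f \<omega>))\<^sup>2) \<in> borel_measurable M"
    using I_measurable[OF f] by simp
  have m': "(\<lambda>\<omega>. (RI (\<lambda>x. Re (f x)) \<omega>)\<^sup>2 + (RI (\<lambda>x. Im (f x)) \<omega>)\<^sup>2) \<in> borel_measurable M"
    using RI_measurable[OF r] RI_measurable[OF i] by simp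
  have ri: "integrable M (\<lambda>\<omega>. (RI (\<lambda>x. Re (f x)) \<omega>)\<^sup>2)" "integrable M (\<lambda>\<omega>. (RI (\<lambda>x. Im (f x)) \<omega>)\<^sup>2)"
    using sq_integrable_RI[OF r] sq_integrable_RI[OF i] by (auto simp: sq_integrable_def)
  show "integrable M (\<lambda>\<omega>. (cmod (I f \<omega>))\<^sup>2)"
    using ri by (subst integrable_cong_AE[OF m m' AE]) simp
  have "(\<integral>\<omega>. (cmod (I f \<omega>))\<^sup>2 \<partial>M) = (\<integral>\<omega>. (RI (\<lambda>x. Re (f x)) \<omega>)\<^sup>2 \<partial>M) + (\<integral>\<omega>. (RI (\<lambda>x. Im (f x)) \<omega>)\<^sup>2 \<partial>M)"
    using ri by (subst integral_cong_AE[OF m m' AE]) simp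
  also have "\<dots> = (\<integral>x. (Re (f x))\<^sup>2 \<partial>P) + (\<integral>x. (Im (f x))\<^sup>2 \<partial>P)"
    using L2_inner_RI[OF r r] L2_inner_RI[OF i i] by (simp add: L2_inner_self)
  also have "\<dots> = (\<integral>x. (cmod (f x))\<^sup>2 \<partial>P)"
    using r i by (simp add: cmod_power2 sq_integrable_def)
  finally show "(\<integral>\<omega>. (cmod (I f \<omega>))\<^sup>2 \<partial>M) = (\<integral>x. (cmod (f x))\<^sup>2 \<partial>P)" .
qed

text \<open>Pairing with a fixed complex number is a real-linear combination of real and imaginary
  part, so the real isometry applies to each of them. The constant will be the value
  \<open>a k t\<close> at a fixed \<open>t\<close>.\<close>

lemma integral_I_inner_times_RI:
  assumes f: "f \<in> L2 P" and u: "sq_integrable P u"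
  shows "(\<integral>\<omega>. (I f \<omega> \<bullet> a) * RI u \<omega> \<partial>M) = (\<integral>x. (f x \<bullet> a) * u x \<partial>P)"
proof -
  have r: "sq_integrable P (\<lambda>x. Re (f x))" and i: "sq_integrable P (\<lambda>x. Im (f x))" using assms by (auto simp: L2_Re_Im)
  note int = integrable_inner_sq_integrable[OF sq_integrable_RI[OF r] sq_integrable_RI[OF u]]
    integrable_inner_sq_integrable[OF sq_integrable_RI[OF i] sq_integrable_RI[OF u]]
    integrable_inner_sq_integrable[OF r u] integrable_inner_sq_integrable[OF i u]
  have "(\<integral>\<omega>. (I f \<omega> \<bullet> a) * RI u \<omega> \<partial>M) =
      (\<integral>\<omega>. Re a * (RI (\<lambda>x. Re (f x)) \<omega> * RI u \<omega>) + Im a * (RI (\<lambda>x. Im (f x)) \<omega> * RI u \<omega>) \<partial>M)"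
  proof (rule integral_cong_AE)
    show "AE \<omega> in M. (I f \<omega> \<bullet> a) * RI u \<omega> =
        Re a * (RI (\<lambda>x. Re (f x)) \<omega> * RI u \<omega>) + Im a * (RI (\<lambda>x. Im (f x)) \<omega> * RI u \<omega>)"
      using I_Re_Im[OF f] by eventually_elim (simp add: inner_complex_def algebra_simps)
  qed (use RI_measurable[OF r] RI_measurable[OF i] RI_measurable[OF u] I_measurable[OF f] in auto)
  also have "\<dots> = Re a * L2_inner M (RI (\<lambda>x. Re (f x))) (RI u) + Im a * L2_inner M (RI (\<lambda>x. Im (f x))) (RI u)"
    using int by (simp add: L2_inner_def)
  also have "\<dots> = Re a * L2_inner P (\<lambda>x. Re (f x)) u + Im a * L2_inner P (\<lambda>x. Im (f x)) u"
    by (simp add: L2_inner_RI r i u)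
  also have "\<dots> = (\<integral>x. Re a * (Re (f x) * u x) + Im a * (Im (f x) * u x) \<partial>P)"
    using int by (simp add: L2_inner_def)
  also have "\<dots> = (\<integral>x. (f x \<bullet> a) * u x \<partial>P)"
    by (simp add: inner_complex_def algebra_simps)
  finally show ?thesis .
qed

end

section \<open>Elements and norm of the projective tensor product\<close>

lemma proj_tensor_finite_sum:
  fixes A :: "nat set"
  assumes "finite A" "\<And>k. k \<in> A \<Longrightarrow> g k \<in> L2 P" "\<And>k. k \<in> A \<Longrightarrow> h k \<in> L2 P"
  shows "(\<lambda>(x, y). \<Sum>k\<in>A. g k x * h k y) \<in> proj_tensor P"
proof -
  \<comment> \<open>The definition asks for infinite series, so a finite sum is padded with zero
    functions.\<close>
  define g' where "g' k = (if k \<in> A then g k else (\<lambda>_. 0))" for k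
  define h' where "h' k = (if k \<in> A then h k else (\<lambda>_. 0))" for k
  have m: "g k \<in> borel_measurable P" "h k \<in> borel_measurable P" if "k \<in> A" for k
    using assms that by (auto simp: L2_def)
  have "(\<lambda>k. g' k x * h' k y) sums (\<Sum>k\<in>A. g k x * h k y)" for x y
    using sums_finite[OF assms(1), of "\<lambda>k. g' k x * h' k y"] by (simp add: g'_def h'_def)
  moreover have "summable (\<lambda>k. L2_norm P (g' k) * L2_norm P (h' k))"
    by (rule summable_finite[OF assms(1)]) (simp add: g'_def L2_norm_def)
  moreover have "g' k \<in> L2 P" "h' k \<in> L2 P" for k
    using assms by (auto simp: g'_def h'_def L2_def)
  ultimately have "tensor_series P g' h' (\<lambda>(x, y). \<Sum>k\<in>A. g k x * h k y)"
    by (simp add: tensor_series_def)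
  moreover have "(\<lambda>(x, y). \<Sum>k\<in>A. g k x * h k y) \<in> borel_measurable (P \<Otimes>\<^sub>M P)"
    using m by measurable
  ultimately show ?thesis
    unfolding proj_tensor_def by blast
qed

lemma proj_norm_le:
  assumes "tensor_series P g h K"
  shows "proj_norm P K \<le> (\<Sum>k. L2_norm P (g k) * L2_norm P (h k))"
  unfolding proj_norm_def
proof (rule cInf_lower)
  show "bdd_below {(\<Sum>k. L2_norm P (g k) * L2_norm P (h k)) | g h. tensor_series P g h K}"
    by (rule bdd_belowI[of _ 0]) (auto simp: tensor_series_def L2_norm_def intro!: suminf_nonneg)
qed (use assms in blast)

text \<open>Membership guarantees that the infimum is taken over a nonempty set.\<close>

lemma proj_norm_nonneg:
  assumes "K \<in> proj_tensor P"
  shows "0 \<le> proj_norm P K"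
  unfolding proj_norm_def
  by (rule cInf_greatest)
    (use assms in \<open>auto simp: proj_tensor_def tensor_series_def L2_norm_def intro!: suminf_nonneg\<close>)

subsection \<open>Gram kernels of square-integrable random fields\<close>

lemma tendsto_0_imp_nonpos:
  fixes c C :: real
  assumes "\<And>n. c \<le> C * r n" "r \<longlonglongrightarrow> 0"
  shows "c \<le> 0"
proof -
  have "(\<lambda>n. C * r n) \<longlonglongrightarrow> 0" using tendsto_mult_left[OF assms(2), of C] by simp
  then show ?thesis by (rule LIMSEQ_le_const) (use assms(1) in auto)
qed

text \<open>Completeness is required only for the functions \<open>e x\<close>, so \<open>a\<close>
  need not span all of \<open>L2\<close>. It is required at every point of \<open>space P\<close>,
  which makes the expansion of the kernel converge pointwise.\<close>

locale kernel_representation = wiener M P I +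
  M: sigma_finite_measure M + P: sigma_finite_measure P + mu: sigma_finite_measure \<mu>
  for M :: "'w measure" and P :: "'a measure" and I and \<mu> :: "'t measure" +
  fixes e :: "'a \<Rightarrow> 't \<Rightarrow> complex" and a :: "nat \<Rightarrow> 't \<Rightarrow> complex"
  assumes e_measurable [measurable]: "(\<lambda>(x, t). e x t) \<in> borel_measurable (P \<Otimes>\<^sub>M \<mu>)"
    and sq_integrable_e: "\<And>x. x \<in> space P \<Longrightarrow> sq_integrable \<mu> (e x)"
    and integrable_e: "integrable P (\<lambda>x. L2_inner \<mu> (e x) (e x))"
    and e_L2: "\<And>t. t \<in> space \<mu> \<Longrightarrow> (\<lambda>x. e x t) \<in> L2 P"
    and ortho: "ortho_seq \<mu> UNIV a"
    and complete: "\<And>x. x \<in> space P \<Longrightarrow> (\<lambda>n. defect \<mu> n a (e x)) \<longlonglongrightarrow> 0"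
begin

sublocale MM: pair_sigma_finite \<mu> M ..
sublocale PP: pair_sigma_finite P \<mu> ..

definition u :: "nat \<Rightarrow> 'a \<Rightarrow> real" where "u k x = L2_inner \<mu> (e x) (a k)"

definition tr :: real where "tr = (\<integral>x. L2_inner \<mu> (e x) (e x) \<partial>P)"

text \<open>The remainder of the trace series. It bounds the projective norm of the kernel remainder
  and is also the expectation of \<open>gap\<close>; its convergence to 0 drives all limits
  below.\<close>

definition tail :: "nat \<Rightarrow> real" where "tail n = tr - (\<Sum>k<n. L2_inner P (u k) (u k))"

lemma sq_integrable_a: "sq_integrable \<mu> (a k)"
  using ortho by (simp add: ortho_seq_def)

lemma a_measurable [measurable]: "a k \<in> borel_measurable \<mu>"
  using sq_integrable_a by (simp add: sq_integrable_def)

lemma ortho_n: "ortho_seq \<mu> {..<n} a"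
  using ortho by (simp add: ortho_seq_def)

lemma u_measurable [measurable]: "u k \<in> borel_measurable P"
  unfolding u_def L2_inner_def by measurable

lemma sum_u_le: "x \<in> space P \<Longrightarrow> (\<Sum>k<n. (u k x)\<^sup>2) \<le> L2_inner \<mu> (e x) (e x)"
  using defect_nonneg[OF ortho_n sq_integrable_e, of x n] by (simp add: defect_def u_def)

lemma sq_integrable_u: "sq_integrable P (u k)"
proof -
  have "(u k x)\<^sup>2 \<le> L2_inner \<mu> (e x) (e x)" if "x \<in> space P" for x
  proof -
    \<comment> \<open>The square is one of the first \<open>Suc k\<close> terms of a Bessel
      sum.\<close>
    have "(u k x)\<^sup>2 \<le> (\<Sum>k<Suc k. (u k x)\<^sup>2)" by (rule member_le_sum) auto
    with sum_u_le[OF that, of "Suc k"] show ?thesis by linarith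
  qed
  then have "integrable P (\<lambda>x. (u k x)\<^sup>2)"
    by (intro Bochner_Integration.integrable_bound[OF integrable_e])
      (auto intro!: AE_I2 simp: L2_inner_self_nonneg)
  then show ?thesis by (simp add: sq_integrable_def)
qed

lemma u_sums: "x \<in> space P \<Longrightarrow> y \<in> space P \<Longrightarrow> (\<lambda>k. u k x * u k y) sums L2_inner \<mu> (e x) (e y)"
  unfolding u_def by (intro L2_inner_parseval ortho sq_integrable_e complete)

text \<open>Integrated over \<open>P\<close>, Bessel's inequality bounds the partial sums by
  \<open>tr\<close>. Sum and integral may then be exchanged, and Parseval on the diagonal identifies
  the limit.\<close>

lemma u_norm_sums: "(\<lambda>k. L2_inner P (u k) (u k)) sums tr"
proof -
  have int: "integrable P (\<lambda>x. (u k x)\<^sup>2)" for k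
    using sq_integrable_u by (simp add: sq_integrable_def)
  have "summable (\<lambda>k. \<integral>x. (u k x)\<^sup>2 \<partial>P)"
  proof (rule bounded_imp_summable[where B = tr])
    fix n
    have "(\<Sum>k\<le>n. \<integral>x. (u k x)\<^sup>2 \<partial>P) = (\<integral>x. (\<Sum>k<Suc n. (u k x)\<^sup>2) \<partial>P)"
      using int by (subst Bochner_Integration.integral_sum) (auto simp: lessThan_Suc_atMost)
    also have "\<dots> \<le> tr"
      unfolding tr_def
      by (intro integral_mono_AE Bochner_Integration.integrable_sum int integrable_e AE_I2 sum_u_le)
    finally show "(\<Sum>k\<le>n. \<integral>x. (u k x)\<^sup>2 \<partial>P) \<le> tr" .
  qed simp
  moreover have "AE x in P. summable (\<lambda>k. norm ((u k x)\<^sup>2))"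
    using u_sums by (auto simp: power2_eq_square sums_iff intro!: AE_I2)
  ultimately have "(\<lambda>k. \<integral>x. (u k x)\<^sup>2 \<partial>P) sums (\<integral>x. (\<Sum>k. (u k x)\<^sup>2) \<partial>P)"
    using int by (intro sums_integral) auto
  also have "(\<integral>x. (\<Sum>k. (u k x)\<^sup>2) \<partial>P) = tr"
    unfolding tr_def using u_sums
    by (intro Bochner_Integration.integral_cong) (auto simp: power2_eq_square sums_iff)
  finally show ?thesis by (simp add: L2_inner_self)
qed

lemma tail_tendsto: "tail \<longlonglongrightarrow> 0"
  using tendsto_diff[OF tendsto_const[of tr] u_norm_sums[unfolded sums_def]]
  by (simp add: tail_def[abs_def])

abbreviation uc :: "nat \<Rightarrow> 'a \<Rightarrow> complex" where
  "uc k \<equiv> (\<lambda>x. complex_of_real (u k x))"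

lemma uc_L2: "uc k \<in> L2 P"
  using sq_integrable_u by (simp add: L2_of_real_iff)

lemma L2_norm_uc: "L2_norm P (uc k) * L2_norm P (uc k) = L2_inner P (u k) (u k)"
  by (simp add: L2_norm_def L2_inner_self)

definition Kn :: "nat \<Rightarrow> 'a \<times> 'a \<Rightarrow> complex" where
  "Kn n = (\<lambda>(x, y). \<Sum>k<n. uc k x * uc k y)"

text \<open>The remainder \<open>K - Kn n\<close> is represented by the elementary tensors with
  index at least \<open>n\<close>. Because each tensor has two equal factors, the sum of the
  products of their norms is a remainder of the trace series. The case \<open>n = 0\<close>
  represents \<open>K\<close> itself.\<close>

lemma tensor_series_tail:
  assumes K: "\<And>x y. x \<in> space P \<Longrightarrow> y \<in> space P \<Longrightarrow> K (x, y) = complex_of_real (L2_inner \<mu> (e x) (e y))"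
  shows "tensor_series P (\<lambda>k. uc (k + n)) (\<lambda>k. uc (k + n)) (\<lambda>z. K z - Kn n z)"
    and "(\<Sum>k. L2_norm P (uc (k + n)) * L2_norm P (uc (k + n))) = tail n"
proof -
  have s: "(\<lambda>k. L2_inner P (u (k + n)) (u (k + n))) sums tail n"
    unfolding tail_def by (rule sums_iff_shift'[THEN iffD2, OF u_norm_sums])
  then show "(\<Sum>k. L2_norm P (uc (k + n)) * L2_norm P (uc (k + n))) = tail n"
    by (simp add: L2_norm_uc sums_iff)
  have "(\<lambda>k. uc (k + n) x * uc (k + n) y) sums (K (x, y) - Kn n (x, y))"
    if "x \<in> space P" "y \<in> space P" for x y
  proof -
    have "(\<lambda>k. uc k x * uc k y) sums K (x, y)"
      using sums_of_real[OF u_sums[OF that], where 'a = complex] by (simp add: K[OF that])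
    then show ?thesis
      using sums_iff_shift'[of "\<lambda>k. uc k x * uc k y" n] by (simp add: Kn_def)
  qed
  moreover have "AE z in P \<Otimes>\<^sub>M P. z \<in> space P \<times> space P"
    by (rule AE_I2) (simp add: space_pair_measure)
  ultimately have "AE (x, y) in P \<Otimes>\<^sub>M P. (\<lambda>k. uc (k + n) x * uc (k + n) y) sums (K (x, y) - Kn n (x, y))"
    by (auto elim!: eventually_mono)
  then show "tensor_series P (\<lambda>k. uc (k + n)) (\<lambda>k. uc (k + n)) (\<lambda>z. K z - Kn n z)"
    using s uc_L2 by (auto simp: tensor_series_def L2_norm_uc sums_iff)
qed

text \<open>Measurability comes from the series: on \<open>space P \<times> space P\<close> the
  kernel equals a pointwise limit of measurable finite sums.\<close>

lemma kernel_proj_tensor: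
  assumes K: "\<And>x y. x \<in> space P \<Longrightarrow> y \<in> space P \<Longrightarrow> K (x, y) = complex_of_real (L2_inner \<mu> (e x) (e y))"
  shows "K \<in> proj_tensor P"
proof -
  have "K \<in> borel_measurable (P \<Otimes>\<^sub>M P) \<longleftrightarrow>
      (\<lambda>z. complex_of_real (\<Sum>k. u k (fst z) * u k (snd z))) \<in> borel_measurable (P \<Otimes>\<^sub>M P)"
    by (rule measurable_cong) (use u_sums in \<open>auto simp: space_pair_measure K sums_iff\<close>)
  moreover have "(\<lambda>z. complex_of_real (\<Sum>k. u k (fst z) * u k (snd z))) \<in> borel_measurable (P \<Otimes>\<^sub>M P)"
    by measurable
  ultimately show ?thesis
    unfolding proj_tensor_def using tensor_series_tail(1)[of K 0, OF K]
    by (auto simp: Kn_def case_prod_unfold)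
qed

lemma double_integral_Kn:
  assumes J: "double_integral M P I J"
  shows "AE \<omega> in M. J (Kn n) \<omega> = complex_of_real (\<Sum>k<n. (RI (u k) \<omega>)\<^sup>2)"
proof (induction n)
  have lin: "AE \<omega> in M. J (\<lambda>z. \<alpha> * K z + \<beta> * L z) \<omega> = \<alpha> * J K \<omega> + \<beta> * J L \<omega>"
    if "K \<in> proj_tensor P" "L \<in> proj_tensor P" for \<alpha> \<beta> K L
    using J that unfolding double_integral_def by blast
  have Kn: "Kn n \<in> proj_tensor P" for n
    unfolding Kn_def by (intro proj_tensor_finite_sum uc_L2) simp
  {
    case 0
    \<comment> \<open>\<open>Kn 0\<close> is the zero kernel; linearity with both coefficients equal
      to 0 evaluates \<open>J\<close> there.\<close>
    show ?case using lin[OF Kn[of 0] Kn[of 0], of 0 0] by (simp add: Kn_def case_prod_unfold)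
  next
    case (Suc n)
    have T: "(\<lambda>(x, y). uc n x * uc n y) \<in> proj_tensor P"
      using proj_tensor_finite_sum[of "{n}" uc P uc] uc_L2 by simp
    have T': "AE \<omega> in M. J (\<lambda>(x, y). uc n x * uc n y) \<omega> = I (uc n) \<omega> * I (uc n) \<omega>"
      by (rule J[unfolded double_integral_def, THEN conjunct2, THEN conjunct2, THEN conjunct2, rule_format,
          OF uc_L2 uc_L2])
    have Suc_eq: "Kn (Suc n) = (\<lambda>z. 1 * Kn n z + 1 * (case z of (x, y) \<Rightarrow> uc n x * uc n y))"
      by (auto simp: Kn_def fun_eq_iff)
    show ?case
      unfolding Suc_eq using lin[OF Kn[of n] T, of 1 1] T' Suc I_of_real[OF sq_integrable_u[of n]]
      by eventually_elim (simp add: power2_eq_square)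
  }
qed

text \<open>Continuity of \<open>J\<close> turns the bound on the projective norm of
  \<open>K - Kn n\<close> into one in \<open>L^1\<close>; linearity and
  \<open>double_integral_Kn\<close> identify the difference.\<close>

lemma double_integral_approx:
  assumes J: "double_integral M P I J"
    and K: "\<And>x y. x \<in> space P \<Longrightarrow> y \<in> space P \<Longrightarrow> K (x, y) = complex_of_real (L2_inner \<mu> (e x) (e y))"
  shows "\<exists>C\<ge>0. \<forall>n. (\<integral>\<omega>. cmod (J K \<omega> - complex_of_real (\<Sum>k<n. (RI (u k) \<omega>)\<^sup>2)) \<partial>M) \<le> C * tail n"
proof -
  obtain C where C: "\<And>K. K \<in> proj_tensor P \<Longrightarrow> (\<integral>\<omega>. cmod (J K \<omega>) \<partial>M) \<le> C * proj_norm P K"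
    using J unfolding double_integral_def by blast
  have KP: "K \<in> proj_tensor P" by (rule kernel_proj_tensor[OF K])
  have "(\<integral>\<omega>. cmod (J K \<omega> - complex_of_real (\<Sum>k<n. (RI (u k) \<omega>)\<^sup>2)) \<partial>M) \<le> \<bar>C\<bar> * tail n" for n
  proof -
    let ?D = "\<lambda>z. K z - Kn n z"
    have Kn: "Kn n \<in> proj_tensor P"
      unfolding Kn_def by (intro proj_tensor_finite_sum uc_L2) simp
    note t = tensor_series_tail[of K n, OF K]
    have "?D \<in> borel_measurable (P \<Otimes>\<^sub>M P)"
      using KP Kn by (auto simp: proj_tensor_def)
    with t(1) have D: "?D \<in> proj_tensor P" unfolding proj_tensor_def by blast
    have "AE \<omega> in M. J (\<lambda>z. 1 * K z + (-1) * Kn n z) \<omega> = 1 * J K \<omega> + (-1) * J (Kn n) \<omega>"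
      using J KP Kn unfolding double_integral_def by blast
    with double_integral_Kn[OF J, of n]
    have AE: "AE \<omega> in M. cmod (J K \<omega> - complex_of_real (\<Sum>k<n. (RI (u k) \<omega>)\<^sup>2)) = cmod (J ?D \<omega>)"
      by eventually_elim simp
    have m: "J K \<in> borel_measurable M" "J ?D \<in> borel_measurable M"
      using J KP D unfolding double_integral_def by auto
    have "(\<integral>\<omega>. cmod (J K \<omega> - complex_of_real (\<Sum>k<n. (RI (u k) \<omega>)\<^sup>2)) \<partial>M) = (\<integral>\<omega>. cmod (J ?D \<omega>) \<partial>M)"
      using m RI_measurable[OF sq_integrable_u] by (intro integral_cong_AE AE) auto
    also have "\<dots> \<le> C * proj_norm P ?D" by (rule C[OF D])
    \<comment> \<open>The constant in the continuity assumption may be negative, hence the absolute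
      value.\<close>
    also have "\<dots> \<le> \<bar>C\<bar> * proj_norm P ?D"
      by (intro mult_right_mono proj_norm_nonneg D) simp
    also have "\<dots> \<le> \<bar>C\<bar> * tail n"
      using proj_norm_le[OF t(1)] t(2) by (intro mult_left_mono) auto
    finally show ?thesis .
  qed
  then show ?thesis by (intro exI[of _ "\<bar>C\<bar>"]) auto
qed

text \<open>This licenses Fubini in \<open>integral_c_times_RI\<close>. The scalar
  \<open>u k x\<close> is moved onto \<open>a k t\<close> before \<open>abs_inner_le_squares\<close>
  is used, so that the majorant integrates over \<open>t\<close> to a function of \<open>x\<close>
  already known to be integrable.\<close>

lemma integrable_inner_a_times_u:
  "integrable (P \<Otimes>\<^sub>M \<mu>) (\<lambda>(x, t). (e x t \<bullet> a k t) * u k x)"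
proof (rule PP.Fubini_integrable)
  show "(\<lambda>(x, t). (e x t \<bullet> a k t) * u k x) \<in> borel_measurable (P \<Otimes>\<^sub>M \<mu>)" by measurable
  show "AE x in P. integrable \<mu> (\<lambda>t. case (x, t) of (x, t) \<Rightarrow> (e x t \<bullet> a k t) * u k x)"
    by (auto intro!: AE_I2 integrable_inner_sq_integrable sq_integrable_e sq_integrable_a)
  show "integrable P (\<lambda>x. \<integral>t. norm (case (x, t) of (x, t) \<Rightarrow> (e x t \<bullet> a k t) * u k x) \<partial>\<mu>)"
  proof (rule Bochner_Integration.integrable_bound)
    show "integrable P (\<lambda>x. L2_inner \<mu> (e x) (e x) + L2_inner \<mu> (a k) (a k) * (u k x)\<^sup>2)"
      using integrable_e sq_integrable_u[of k] by (auto simp: sq_integrable_def)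
    have "(\<integral>t. norm ((e x t \<bullet> a k t) * u k x) \<partial>\<mu>) \<le> L2_inner \<mu> (e x) (e x) + L2_inner \<mu> (a k) (a k) * (u k x)\<^sup>2"
      if "x \<in> space P" for x
    proof -
      note ex = sq_integrable_e[OF that]
      have "(\<integral>t. norm ((e x t \<bullet> a k t) * u k x) \<partial>\<mu>) \<le> (\<integral>t. (cmod (e x t))\<^sup>2 + (u k x)\<^sup>2 * (cmod (a k t))\<^sup>2 \<partial>\<mu>)"
      proof (rule integral_mono)
        show "norm ((e x t \<bullet> a k t) * u k x) \<le> (cmod (e x t))\<^sup>2 + (u k x)\<^sup>2 * (cmod (a k t))\<^sup>2" for t
        proof -
          have "\<bar>(e x t \<bullet> (u k x *\<^sub>R a k t))\<bar> \<le> (cmod (e x t))\<^sup>2 + (cmod (u k x *\<^sub>R a k t))\<^sup>2"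
            by (rule abs_inner_le_squares)
          then show ?thesis by (simp add: power_mult_distrib mult.commute)
        qed
      qed (use ex sq_integrable_a[of k] integrable_inner_sq_integrable[OF ex sq_integrable_a[of k]] in \<open>auto simp: sq_integrable_def\<close>)
      also have "\<dots> = L2_inner \<mu> (e x) (e x) + L2_inner \<mu> (a k) (a k) * (u k x)\<^sup>2"
        using ex sq_integrable_a[of k] by (simp add: L2_inner_self sq_integrable_def)
      finally show ?thesis .
    qed
    then show "AE x in P. norm (\<integral>t. norm (case (x, t) of (x, t) \<Rightarrow> (e x t \<bullet> a k t) * u k x) \<partial>\<mu>)
        \<le> norm (L2_inner \<mu> (e x) (e x) + L2_inner \<mu> (a k) (a k) * (u k x)\<^sup>2)"
      by (auto intro!: AE_I2 order_trans[OF _ abs_ge_self])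
  qed measurable
qed

end

section \<open>The random field and its coefficients\<close>

locale kernel_field = kernel_representation M P I \<mu> e a
  for M :: "'w measure" and P :: "'a measure" and I and \<mu> :: "'t measure" and e a +
  fixes G :: "'t \<Rightarrow> 'w \<Rightarrow> complex"
  assumes G_measurable [measurable]: "(\<lambda>(t, \<omega>). G t \<omega>) \<in> borel_measurable (\<mu> \<Otimes>\<^sub>M M)"
    and G_eq: "\<And>t. t \<in> space \<mu> \<Longrightarrow> AE \<omega> in M. G t \<omega> = I (\<lambda>x. e x t) \<omega>"
begin

text \<open>For each fixed \<open>t\<close> the second moment of \<open>G t\<close> is that of the
  Wiener integral of \<open>e _ t\<close>, so the exceptional null set may depend on
  \<open>t\<close>. The isometry and Tonelli then lead to the trace.\<close>

lemma nn_integral_G: "(\<integral>\<^sup>+ z. ennreal ((cmod (case z of (t, \<omega>) \<Rightarrow> G t \<omega>))\<^sup>2) \<partial>(\<mu> \<Otimes>\<^sub>M M)) = ennreal tr"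
proof -
  have "(\<integral>\<^sup>+ z. ennreal ((cmod (case z of (t, \<omega>) \<Rightarrow> G t \<omega>))\<^sup>2) \<partial>(\<mu> \<Otimes>\<^sub>M M)) =
      (\<integral>\<^sup>+ t. (\<integral>\<^sup>+ \<omega>. ennreal ((cmod (G t \<omega>))\<^sup>2) \<partial>M) \<partial>\<mu>)"
    by (subst M.nn_integral_fst[symmetric]) auto
  also have "\<dots> = (\<integral>\<^sup>+ t. (\<integral>\<^sup>+ x. ennreal ((cmod (e x t))\<^sup>2) \<partial>P) \<partial>\<mu>)"
  proof (rule nn_integral_cong)
    fix t assume t: "t \<in> space \<mu>"
    have "(\<integral>\<^sup>+ \<omega>. ennreal ((cmod (G t \<omega>))\<^sup>2) \<partial>M) = (\<integral>\<^sup>+ \<omega>. ennreal ((cmod (I (\<lambda>x. e x t) \<omega>))\<^sup>2) \<partial>M)"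
      by (rule nn_integral_cong_AE) (use G_eq[OF t] in \<open>eventually_elim, simp\<close>)
    also have "\<dots> = (\<integral>\<^sup>+ x. ennreal ((cmod (e x t))\<^sup>2) \<partial>P)"
      using integrable_norm_I_square[OF e_L2[OF t]] e_L2[OF t]
      by (simp add: nn_integral_eq_integral L2_def)
    finally show "(\<integral>\<^sup>+ \<omega>. ennreal ((cmod (G t \<omega>))\<^sup>2) \<partial>M) = (\<integral>\<^sup>+ x. ennreal ((cmod (e x t))\<^sup>2) \<partial>P)" .
  qed
  also have "\<dots> = (\<integral>\<^sup>+ x. (\<integral>\<^sup>+ t. ennreal ((cmod (e x t))\<^sup>2) \<partial>\<mu>) \<partial>P)"
    by (rule PP.Fubini') measurable
  also have "\<dots> = (\<integral>\<^sup>+ x. ennreal (L2_inner \<mu> (e x) (e x)) \<partial>P)"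
    using sq_integrable_e by (intro nn_integral_cong) (simp add: nn_integral_eq_integral sq_integrable_def L2_inner_self)
  also have "\<dots> = ennreal tr"
    unfolding tr_def by (intro nn_integral_eq_integral integrable_e) (simp add: L2_inner_self_nonneg)
  finally show ?thesis .
qed

lemma integrable_G: "integrable (\<mu> \<Otimes>\<^sub>M M) (\<lambda>(t, \<omega>). (cmod (G t \<omega>))\<^sup>2)"
proof (rule integrableI_bounded)
  show "(\<integral>\<^sup>+ z. ennreal (norm (case z of (t, \<omega>) \<Rightarrow> (cmod (G t \<omega>))\<^sup>2)) \<partial>(\<mu> \<Otimes>\<^sub>M M)) < \<infinity>"
    using nn_integral_G by (simp add: case_prod_unfold)
qed measurable

lemma tr_nonneg: "0 \<le> tr"
  unfolding tr_def by (simp add: L2_inner_self_nonneg)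

lemma integral_norm_G:
  "integrable M (\<lambda>\<omega>. L2_inner \<mu> (\<lambda>t. G t \<omega>) (\<lambda>t. G t \<omega>))"
  "(\<integral>\<omega>. L2_inner \<mu> (\<lambda>t. G t \<omega>) (\<lambda>t. G t \<omega>) \<partial>M) = tr"
proof -
  show "integrable M (\<lambda>\<omega>. L2_inner \<mu> (\<lambda>t. G t \<omega>) (\<lambda>t. G t \<omega>))"
    unfolding L2_inner_self by (rule MM.integrable_snd[OF integrable_G])
  have "(\<integral>\<omega>. L2_inner \<mu> (\<lambda>t. G t \<omega>) (\<lambda>t. G t \<omega>) \<partial>M) = (\<integral>(t, \<omega>). (cmod (G t \<omega>))\<^sup>2 \<partial>(\<mu> \<Otimes>\<^sub>M M))"
    unfolding L2_inner_self by (rule MM.integral_snd[OF integrable_G])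
  also have "\<dots> = tr"
    by (rule integral_eq_nn_integral[THEN trans])
      (use nn_integral_G tr_nonneg in \<open>auto simp: case_prod_unfold\<close>)
  finally show "(\<integral>\<omega>. L2_inner \<mu> (\<lambda>t. G t \<omega>) (\<lambda>t. G t \<omega>) \<partial>M) = tr" .
qed

lemma AE_sq_integrable_G: "AE \<omega> in M. sq_integrable \<mu> (\<lambda>t. G t \<omega>)"
  using MM.AE_integrable_snd[OF integrable_G] AE_space
  by eventually_elim (auto simp: sq_integrable_def)

abbreviation c :: "nat \<Rightarrow> 'w \<Rightarrow> real" where "c k \<omega> \<equiv> L2_inner \<mu> (\<lambda>t. G t \<omega>) (a k)"

text \<open>Fubini moves the expectation inside, where for each \<open>t\<close> the Wiener isometry
  replaces \<open>G t\<close> by \<open>e _ t\<close> and \<open>RI (u k)\<close> by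
  \<open>u k\<close>. A second use of Fubini over \<open>P\<close> and \<open>\<mu>\<close> turns
  the integral over \<open>t\<close> into \<open>u k\<close>.\<close>

lemma integral_c_times_RI:
  "integrable M (\<lambda>\<omega>. c k \<omega> * RI (u k) \<omega>)"
  "(\<integral>\<omega>. c k \<omega> * RI (u k) \<omega> \<partial>M) = L2_inner P (u k) (u k)"
proof -
  note [measurable] = RI_measurable[OF sq_integrable_u, of k]
  have int: "integrable (\<mu> \<Otimes>\<^sub>M M) (\<lambda>(t, \<omega>). (G t \<omega> \<bullet> a k t) * RI (u k) \<omega>)"
  proof (rule Bochner_Integration.integrable_bound)
    have "integrable (\<mu> \<Otimes>\<^sub>M M) (\<lambda>(t, \<omega>). (cmod (a k t))\<^sup>2 * (RI (u k) \<omega>)\<^sup>2)"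
      by (intro MM.Fubini_integrable)
        (use sq_integrable_a[of k] sq_integrable_RI[OF sq_integrable_u[of k]] in \<open>auto simp: sq_integrable_def\<close>)
    from Bochner_Integration.integrable_add[OF integrable_G this]
    show "integrable (\<mu> \<Otimes>\<^sub>M M) (\<lambda>z. (case z of (t, \<omega>) \<Rightarrow> (cmod (G t \<omega>))\<^sup>2) +
        (case z of (t, \<omega>) \<Rightarrow> (cmod (a k t))\<^sup>2 * (RI (u k) \<omega>)\<^sup>2))" .
    have "\<bar>(G t \<omega> \<bullet> a k t) * RI (u k) \<omega>\<bar> \<le> (cmod (G t \<omega>))\<^sup>2 + (cmod (a k t))\<^sup>2 * (RI (u k) \<omega>)\<^sup>2" for t \<omega>
      using abs_inner_le_squares[of "G t \<omega>" "RI (u k) \<omega> *\<^sub>R a k t"]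
      by (simp add: power_mult_distrib mult.commute)
    then show "AE z in \<mu> \<Otimes>\<^sub>M M. norm (case z of (t, \<omega>) \<Rightarrow> (G t \<omega> \<bullet> a k t) * RI (u k) \<omega>)
        \<le> norm ((case z of (t, \<omega>) \<Rightarrow> (cmod (G t \<omega>))\<^sup>2) + (case z of (t, \<omega>) \<Rightarrow> (cmod (a k t))\<^sup>2 * (RI (u k) \<omega>)\<^sup>2))"
      by (auto simp: case_prod_unfold intro!: AE_I2)
  qed measurable
  show "integrable M (\<lambda>\<omega>. c k \<omega> * RI (u k) \<omega>)"
    using MM.integrable_snd[OF int] by (simp add: L2_inner_def)
  have "(\<integral>\<omega>. c k \<omega> * RI (u k) \<omega> \<partial>M) = (\<integral>\<omega>. (\<integral>t. (G t \<omega> \<bullet> a k t) * RI (u k) \<omega> \<partial>\<mu>) \<partial>M)"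
    by (simp add: L2_inner_def)
  also have "\<dots> = (\<integral>t. (\<integral>\<omega>. (G t \<omega> \<bullet> a k t) * RI (u k) \<omega> \<partial>M) \<partial>\<mu>)"
    by (rule MM.Fubini_integral[OF int])
  also have "\<dots> = (\<integral>t. (\<integral>x. (e x t \<bullet> a k t) * u k x \<partial>P) \<partial>\<mu>)"
  proof (rule Bochner_Integration.integral_cong[OF refl])
    fix t assume t: "t \<in> space \<mu>"
    have "(\<integral>\<omega>. (G t \<omega> \<bullet> a k t) * RI (u k) \<omega> \<partial>M) = (\<integral>\<omega>. (I (\<lambda>x. e x t) \<omega> \<bullet> a k t) * RI (u k) \<omega> \<partial>M)"
    proof (rule integral_cong_AE)
      show "AE \<omega> in M. (G t \<omega> \<bullet> a k t) * RI (u k) \<omega> = (I (\<lambda>x. e x t) \<omega> \<bullet> a k t) * RI (u k) \<omega>"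
        using G_eq[OF t] by eventually_elim simp
    qed (use t I_measurable[OF e_L2[OF t]] in measurable)
    also have "\<dots> = (\<integral>x. (e x t \<bullet> a k t) * u k x \<partial>P)"
      by (rule integral_I_inner_times_RI[OF e_L2[OF t] sq_integrable_u])
    finally show "(\<integral>\<omega>. (G t \<omega> \<bullet> a k t) * RI (u k) \<omega> \<partial>M) = (\<integral>x. (e x t \<bullet> a k t) * u k x \<partial>P)" .
  qed
  also have "\<dots> = (\<integral>x. (\<integral>t. (e x t \<bullet> a k t) * u k x \<partial>\<mu>) \<partial>P)"
    by (rule PP.Fubini_integral) (rule integrable_inner_a_times_u)
  also have "\<dots> = L2_inner P (u k) (u k)"
    by (simp add: L2_inner_def u_def)
  finally show "(\<integral>\<omega>. c k \<omega> * RI (u k) \<omega> \<partial>M) = L2_inner P (u k) (u k)" .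
qed

text \<open>If every \<open>a k\<close> has norm 1, this is the squared distance from the path of
  \<open>G\<close> to the sum of the \<open>RI (u k) \<omega> * a k\<close>. The expanded form
  allows the expectation to be computed term by term: \<open>tr - 2 s + s\<close> with
  \<open>s\<close> a partial sum of the trace.\<close>

definition gap :: "nat \<Rightarrow> 'w \<Rightarrow> real" where
  "gap n \<omega> = L2_inner \<mu> (\<lambda>t. G t \<omega>) (\<lambda>t. G t \<omega>) - 2 * (\<Sum>k<n. c k \<omega> * RI (u k) \<omega>) + (\<Sum>k<n. (RI (u k) \<omega>)\<^sup>2)"

lemma integral_gap: "integrable M (gap n)" "(\<integral>\<omega>. gap n \<omega> \<partial>M) = tail n"
proof -
  have i: "integrable M (\<lambda>\<omega>. (RI (u k) \<omega>)\<^sup>2)" "(\<integral>\<omega>. (RI (u k) \<omega>)\<^sup>2 \<partial>M) = L2_inner P (u k) (u k)" for k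
    using sq_integrable_RI[OF sq_integrable_u[of k]] L2_inner_RI[OF sq_integrable_u sq_integrable_u, of k k]
    by (auto simp: sq_integrable_def L2_inner_self)
  note int = i integral_norm_G integral_c_times_RI
  show "integrable M (gap n)"
    unfolding gap_def[abs_def] using int by auto
  show "(\<integral>\<omega>. gap n \<omega> \<partial>M) = tail n"
    unfolding gap_def[abs_def] tail_def using int by simp
qed

text \<open>Completing the square. In this form \<open>gap\<close> is a Bessel defect plus a sum of
  squares, so it is nonnegative on square-integrable paths and controls each single deviation
  \<open>c k - RI (u k)\<close>.\<close>

lemma gap_eq:
  "gap n \<omega> = defect \<mu> n a (\<lambda>t. G t \<omega>) + (\<Sum>k<n. (c k \<omega> - RI (u k) \<omega>)\<^sup>2)"
  by (simp add: gap_def defect_def power2_diff sum.distrib sum_subtractf sum_distrib_left algebra_simps)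

lemma AE_gap_ge:
  "AE \<omega> in M. \<forall>n. 0 \<le> defect \<mu> n a (\<lambda>t. G t \<omega>) \<and> (\<forall>k<n. (c k \<omega> - RI (u k) \<omega>)\<^sup>2 \<le> gap n \<omega>)"
  using AE_sq_integrable_G
proof eventually_elim
  case (elim \<omega>)
  show ?case
  proof (intro allI conjI impI)
    fix n
    show *: "0 \<le> defect \<mu> n a (\<lambda>t. G t \<omega>)" by (rule defect_nonneg[OF ortho_n elim])
    fix k assume "k < n"
    then have "(c k \<omega> - RI (u k) \<omega>)\<^sup>2 \<le> (\<Sum>k<n. (c k \<omega> - RI (u k) \<omega>)\<^sup>2)"
      by (intro member_le_sum) auto
    then show "(c k \<omega> - RI (u k) \<omega>)\<^sup>2 \<le> gap n \<omega>"
      using * by (simp add: gap_eq)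
  qed
qed

text \<open>The squared deviation at a fixed \<open>k\<close> lies below \<open>gap n\<close> for
  all \<open>n > k\<close>, and the expectations of these gaps tend to 0.\<close>

lemma AE_c_eq: "AE \<omega> in M. \<forall>k. c k \<omega> = RI (u k) \<omega>"
  unfolding AE_all_countable
proof
  fix k
  let ?q = "\<lambda>\<omega>. (c k \<omega> - RI (u k) \<omega>)\<^sup>2"
  note [measurable] = RI_measurable[OF sq_integrable_u, of k]
  have m: "?q \<in> borel_measurable M" unfolding L2_inner_def by measurable
  have le: "AE \<omega> in M. ?q \<omega> \<le> gap n \<omega>" if "k < n" for n
    using AE_gap_ge by eventually_elim (use that in blast)
  have int: "integrable M ?q"
    using le[of "Suc k"] by (intro Bochner_Integration.integrable_bound[OF integral_gap(1)[of "Suc k"] m]) auto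
  \<comment> \<open>The shift by \<open>Suc k\<close> guarantees \<open>k < n + Suc k\<close> for
    every \<open>n\<close>.\<close>
  have "(\<integral>\<omega>. ?q \<omega> \<partial>M) \<le> 1 * tail (n + Suc k)" for n
    using integral_mono_AE[OF int integral_gap(1) le, of "n + Suc k"] by (simp add: integral_gap(2))
  moreover have "(\<lambda>n. tail (n + Suc k)) \<longlonglongrightarrow> 0"
    by (rule LIMSEQ_ignore_initial_segment[OF tail_tendsto])
  ultimately have "(\<integral>\<omega>. ?q \<omega> \<partial>M) \<le> 0" by (rule tendsto_0_imp_nonpos)
  then have "(\<integral>\<omega>. ?q \<omega> \<partial>M) = 0" by (simp add: antisym)
  then have "AE \<omega> in M. ?q \<omega> = 0"
    using integral_nonneg_eq_0_iff_AE[OF int] by simp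
  then show "AE \<omega> in M. c k \<omega> = RI (u k) \<omega>" by eventually_elim simp
qed

text \<open>Both sides are \<open>L^1\<close> limits of the sums of the squares
  \<open>(RI (u k))\<^sup>2\<close>: the double integral by continuity of \<open>J\<close>, the
  squared norm because the difference is \<open>gap n\<close>. The two errors have expectation at
  most \<open>C * tail n\<close> and \<open>tail n\<close>.\<close>

theorem norm_square_eq_double_integral:
  assumes J: "double_integral M P I J"
    and K: "\<And>x y. x \<in> space P \<Longrightarrow> y \<in> space P \<Longrightarrow> K (x, y) = complex_of_real (L2_inner \<mu> (e x) (e y))"
  shows "AE \<omega> in M. integrable \<mu> (\<lambda>t. (cmod (G t \<omega>))\<^sup>2) \<and>
    complex_of_real (\<integral>t. (cmod (G t \<omega>))\<^sup>2 \<partial>\<mu>) = J K \<omega>"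
proof -
  obtain C where C: "C \<ge> 0"
    "\<And>n. (\<integral>\<omega>. cmod (J K \<omega> - complex_of_real (\<Sum>k<n. (RI (u k) \<omega>)\<^sup>2)) \<partial>M) \<le> C * tail n"
    using double_integral_approx[OF J, of K, OF K] by blast
  have "K \<in> proj_tensor P" by (rule kernel_proj_tensor[OF K])
  with J have JK: "integrable M (J K)" unfolding double_integral_def by blast
  let ?N = "\<lambda>\<omega>. L2_inner \<mu> (\<lambda>t. G t \<omega>) (\<lambda>t. G t \<omega>)"
  let ?d = "\<lambda>\<omega>. cmod (J K \<omega> - complex_of_real (?N \<omega>))"
  let ?s = "\<lambda>n \<omega>. cmod (J K \<omega> - complex_of_real (\<Sum>k<n. (RI (u k) \<omega>)\<^sup>2))"
  have int: "integrable M ?d"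
    using JK integral_norm_G(1) by (intro integrable_norm Bochner_Integration.integrable_diff integrable_of_real)
  have ints: "integrable M (?s n)" for n
    using JK sq_integrable_RI[OF sq_integrable_u] unfolding sq_integrable_def real_norm_def power2_abs
    by (intro integrable_norm Bochner_Integration.integrable_diff integrable_of_real Bochner_Integration.integrable_sum) auto
  have "(\<integral>\<omega>. ?d \<omega> \<partial>M) \<le> (C + 1) * tail n" for n
  proof -
    have "AE \<omega> in M. ?d \<omega> \<le> ?s n \<omega> + gap n \<omega>"
      using AE_gap_ge AE_c_eq
    proof eventually_elim
      case (elim \<omega>)
      \<comment> \<open>Once \<open>c k = RI (u k)\<close>, the squares in \<open>gap_eq\<close>
        vanish and only the Bessel defect of the path remains.\<close>
      have g: "gap n \<omega> = ?N \<omega> - (\<Sum>k<n. (RI (u k) \<omega>)\<^sup>2)" "gap n \<omega> \<ge> 0"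
        using elim by (simp_all add: gap_eq defect_def)
      have "?d \<omega> = cmod ((J K \<omega> - complex_of_real (\<Sum>k<n. (RI (u k) \<omega>)\<^sup>2)) - complex_of_real (gap n \<omega>))"
        by (simp add: g(1))
      also have "\<dots> \<le> ?s n \<omega> + cmod (complex_of_real (gap n \<omega>))" by (rule norm_triangle_ineq4)
      finally show ?case using g(2) by simp
    qed
    then have "(\<integral>\<omega>. ?d \<omega> \<partial>M) \<le> (\<integral>\<omega>. ?s n \<omega> + gap n \<omega> \<partial>M)"
      by (intro integral_mono_AE int Bochner_Integration.integrable_add ints integral_gap(1))
    also have "\<dots> = (\<integral>\<omega>. ?s n \<omega> \<partial>M) + tail n"
      using ints integral_gap by simp
    finally show ?thesis using C(2)[of n] by (simp add: algebra_simps)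
  qed
  then have "(\<integral>\<omega>. ?d \<omega> \<partial>M) \<le> 0" using tail_tendsto by (rule tendsto_0_imp_nonpos)
  then have "(\<integral>\<omega>. ?d \<omega> \<partial>M) = 0" by (simp add: antisym)
  then have "AE \<omega> in M. ?d \<omega> = 0"
    using integral_nonneg_eq_0_iff_AE[OF int] by simp
  with AE_sq_integrable_G show ?thesis
    by eventually_elim (simp add: sq_integrable_def L2_inner_self)
qed

end

subsection \<open>A single coordinate\<close>

lemma one_minus_cos_eq: "1 - cos x = 2 * (sin (x / 2))\<^sup>2" for x :: real
  using cos_double_sin[of "x / 2"] by simp

lemma one_minus_cos_le: "1 - cos x \<le> x\<^sup>2 / 2" for x :: real
  using power_mono[OF abs_sin_x_le_abs_x[of "x / 2"], of 2]
  by (simp add: one_minus_cos_eq power_divide)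

text \<open>Since \<open>1 - cos\<close> is twice the squared sine of the half angle, this is the
  addition formula for the sine together with \<open>(p - q)^2 <= 2 p^2 + 2 q^2\<close>.\<close>

lemma one_minus_cos_diff_le: "1 - cos (a - b) \<le> 2 * (1 - cos a) + 2 * (1 - cos b)" for a b :: real
proof -
  let ?p = "sin (a / 2) * cos (b / 2)" and ?q = "cos (a / 2) * sin (b / 2)"
  have "(sin ((a - b) / 2))\<^sup>2 = (?p - ?q)\<^sup>2"
    by (simp add: diff_divide_distrib sin_diff)
  also have "\<dots> \<le> 2 * ?p\<^sup>2 + 2 * ?q\<^sup>2"
    using zero_le_power2[of "?p + ?q"] by (simp add: power2_sum power2_diff)
  also have "\<dots> \<le> 2 * (sin (a / 2))\<^sup>2 + 2 * (sin (b / 2))\<^sup>2"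
    by (intro add_mono mult_left_mono)
      (auto simp: power_mult_distrib abs_square_le_1 intro!: mult_left_le mult_left_le_one_le)
  finally show ?thesis by (simp add: one_minus_cos_eq)
qed

lemma dot_diff: "dot d (x - y) t = dot d x t - dot d y t"
  by (simp add: dot_def sum_subtractf algebra_simps)

lemma dot_measurable:
  assumes "\<And>k. k < d \<Longrightarrow> (\<lambda>z. f z k) \<in> borel_measurable N" "\<And>k. k < d \<Longrightarrow> (\<lambda>z. g z k) \<in> borel_measurable N"
  shows "(\<lambda>z. dot d (f z) (g z)) \<in> borel_measurable N"
  unfolding dot_def using assms by (intro borel_measurable_sum borel_measurable_times) auto

text \<open>Away from the origin the trivial bound 2 is used, near it the quadratic bound with
  Cauchy-Schwarz. The factor \<open>2 + dot d x x\<close> covers both and grows controllably with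
  \<open>x\<close>, which matters for dominated convergence in \<open>psi_tendsto\<close>.\<close>

lemma one_minus_cos_dot_le: "1 - cos (dot d x t) \<le> (2 + dot d x x) * min 1 (dot d t t)"
proof -
  have nn: "0 \<le> dot d x x" "0 \<le> dot d t t" by (simp_all add: dot_def sum_nonneg)
  show ?thesis
  proof (cases "dot d t t \<ge> 1")
    case True
    have "1 - cos (dot d x t) \<le> 2" using cos_ge_minus_one[of "dot d x t"] by linarith
    also have "2 \<le> (2 + dot d x x) * min 1 (dot d t t)" using True nn by simp
    finally show ?thesis .
  next
    case False
    have "1 - cos (dot d x t) \<le> (dot d x t)\<^sup>2 / 2" by (rule one_minus_cos_le)
    also have "(dot d x t)\<^sup>2 \<le> dot d x x * dot d t t"
      unfolding dot_def power2_eq_square[symmetric] using Cauchy_Schwarz_ineq_sum .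
    also have "dot d x x * dot d t t / 2 \<le> (2 + dot d x x) * dot d t t"
      using nn by (simp add: algebra_simps)
    finally show ?thesis using False by simp
  qed
qed

locale coordinate = prob_space M for M :: "'w measure" +
  fixes d :: nat and \<rho> :: "(nat \<Rightarrow> real) measure" and X X' :: "'w \<Rightarrow> nat \<Rightarrow> real"
  assumes adm: "admissible_measure d \<rho>"
    and indep: "indep_var (euc d) X (euc d) X'"
    and same_law: "distr M (euc d) X' = distr M (euc d) X"
    and psi_finite: "(\<integral>\<^sup>+ \<omega>. ennreal (psi d \<rho> (X \<omega>)) \<partial>M) < \<infinity>"
begin

sublocale rho: sigma_finite_measure \<rho>
  using adm by (simp add: admissible_measure_def)

sublocale Mrho: pair_sigma_finite M \<rho> ..

lemma X_rv [measurable]: "X \<in> measurable M (euc d)" "X' \<in> measurable M (euc d)"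
  using indep_var_rv1[OF indep] indep_var_rv2[OF indep] .

lemma component_measurable:
  "k < d \<Longrightarrow> (\<lambda>t. t k) \<in> borel_measurable \<rho>" "k < d \<Longrightarrow> (\<lambda>t. t k) \<in> borel_measurable (euc d)"
proof -
  assume k: "k < d"
  show *: "(\<lambda>t. t k) \<in> borel_measurable (euc d)"
    unfolding euc_def using k by (intro measurable_component_singleton) auto
  show "(\<lambda>t. t k) \<in> borel_measurable \<rho>"
    using * adm by (simp add: admissible_measure_def cong: measurable_cong_sets)
qed

text \<open>A difference of vectors takes the value \<open>undefined - undefined = 0\<close> off
  \<open>{..<d}\<close> and so may leave the space of \<open>euc d\<close>. Measurability is
  therefore recorded only for the coordinates that \<open>dot d\<close> sees.\<close>

definition vec_rv :: "'z measure \<Rightarrow> ('z \<Rightarrow> nat \<Rightarrow> real) \<Rightarrow> bool" where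
  "vec_rv N Y \<longleftrightarrow> (\<forall>k<d. (\<lambda>z. Y z k) \<in> borel_measurable N)"

lemma vec_rv_intros:
  "vec_rv N (\<lambda>_. x)" "vec_rv M X" "vec_rv M X'" "vec_rv \<rho> (\<lambda>t. t)" "vec_rv (euc d) (\<lambda>t. t)"
  "vec_rv N Y \<Longrightarrow> vec_rv N Z \<Longrightarrow> vec_rv N (\<lambda>\<omega>. Y \<omega> - Z \<omega>)"
  using component_measurable measurable_compose[OF X_rv(1) component_measurable(2)]
    measurable_compose[OF X_rv(2) component_measurable(2)]
  by (auto simp: vec_rv_def intro!: borel_measurable_diff)

lemma dot_rv: "vec_rv N Y \<Longrightarrow> vec_rv N Z \<Longrightarrow> (\<lambda>z. dot d (Y z) (Z z)) \<in> borel_measurable N"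
  unfolding vec_rv_def by (intro dot_measurable) auto

lemma vec_rv_fst: "vec_rv N Y \<Longrightarrow> vec_rv (N \<Otimes>\<^sub>M L) (\<lambda>p. Y (fst p))"
  unfolding vec_rv_def by (auto intro: measurable_compose[OF measurable_fst])

lemma vec_rv_snd: "vec_rv L Y \<Longrightarrow> vec_rv (N \<Otimes>\<^sub>M L) (\<lambda>p. Y (snd p))"
  unfolding vec_rv_def by (auto intro: measurable_compose[OF measurable_snd])

lemma dot_rv_pair:
  "vec_rv N Y \<Longrightarrow> (\<lambda>z. dot d (Y (fst z)) (snd z)) \<in> borel_measurable (N \<Otimes>\<^sub>M \<rho>)"
  by (rule dot_rv[OF vec_rv_fst vec_rv_snd[OF vec_rv_intros(4)]])

lemma dot_borel [measurable]: "dot d x \<in> borel_measurable \<rho>"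
  using dot_rv[OF vec_rv_intros(1)[of \<rho> x] vec_rv_intros(4)] by simp

lemma integrable_min: "integrable \<rho> (\<lambda>t. min 1 (dot d t t))"
proof (rule integrableI_bounded)
  have "0 \<le> dot d t t" for t by (simp add: dot_def sum_nonneg)
  then show "(\<integral>\<^sup>+ t. ennreal (norm (min 1 (dot d t t))) \<partial>\<rho>) < \<infinity>"
    using adm by (simp add: admissible_measure_def)
  show "(\<lambda>t. min 1 (dot d t t)) \<in> borel_measurable \<rho>"
    using dot_rv[OF vec_rv_intros(4) vec_rv_intros(4)] by simp
qed

lemma integrable_psi: "integrable \<rho> (\<lambda>t. 1 - cos (dot d x t))"
  by (rule Bochner_Integration.integrable_bound[OF integrable_mult_right[OF integrable_min, of "2 + dot d x x"]])
    (auto intro!: AE_I2 order_trans[OF one_minus_cos_dot_le] order_trans[OF _ abs_ge_self])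

lemma psi_nonneg: "0 \<le> psi d \<rho> x"
  unfolding psi_def by simp

text \<open>A quasi-triangle inequality: finiteness of the expectation of \<open>psi\<close> at
  \<open>X\<close> passes through it to all the differences occurring in \<open>Psi\<close>.\<close>

lemma psi_diff_le: "psi d \<rho> (x - y) \<le> 2 * psi d \<rho> x + 2 * psi d \<rho> y"
proof -
  have "psi d \<rho> (x - y) \<le> (\<integral>t. 2 * (1 - cos (dot d x t)) + 2 * (1 - cos (dot d y t)) \<partial>\<rho>)"
    unfolding psi_def dot_diff
    by (intro integral_mono one_minus_cos_diff_le Bochner_Integration.integrable_add integrable_mult_right integrable_psi)
      (use integrable_psi[of "x - y"] in \<open>simp add: dot_diff\<close>)
  also have "\<dots> = 2 * psi d \<rho> x + 2 * psi d \<rho> y"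
    unfolding psi_def
    by (simp only: Bochner_Integration.integral_add[OF integrable_mult_right[OF integrable_psi]
          integrable_mult_right[OF integrable_psi]] integral_mult_right_zero)
  finally show ?thesis .
qed

lemma psi_rv_measurable: "vec_rv N Y \<Longrightarrow> (\<lambda>\<omega>. psi d \<rho> (Y \<omega>)) \<in> borel_measurable N"
  unfolding psi_def
  by (intro rho.borel_measurable_lebesgue_integral)
    (auto simp: case_prod_unfold intro!: borel_measurable_diff dot_rv_pair measurable_compose[OF _ borel_measurable_cos])

lemma integrable_psi_X: "integrable M (\<lambda>\<omega>. psi d \<rho> (X \<omega>))" "integrable M (\<lambda>\<omega>. psi d \<rho> (X' \<omega>))"
proof -
  have [measurable]: "psi d \<rho> \<in> borel_measurable (euc d)"
    using psi_rv_measurable[OF vec_rv_intros(5)] by simp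
  show *: "integrable M (\<lambda>\<omega>. psi d \<rho> (X \<omega>))"
    using psi_finite psi_nonneg by (intro integrableI_bounded) auto
  \<comment> \<open>Integrability is a property of the law, which \<open>X\<close> and
    \<open>X'\<close> share.\<close>
  then have "integrable (distr M (euc d) X) (psi d \<rho>)" by (simp add: integrable_distr_eq)
  then show "integrable M (\<lambda>\<omega>. psi d \<rho> (X' \<omega>))"
    unfolding same_law[symmetric] by (simp add: integrable_distr_eq)
qed

lemma integrable_psi_diff:
  assumes "vec_rv M Y" "vec_rv M Z" "integrable M (\<lambda>\<omega>. psi d \<rho> (Y \<omega>))" "integrable M (\<lambda>\<omega>. psi d \<rho> (Z \<omega>))"
  shows "integrable M (\<lambda>\<omega>. psi d \<rho> (Y \<omega> - Z \<omega>))"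
  by (rule Bochner_Integration.integrable_bound[of _ "\<lambda>\<omega>. 2 * psi d \<rho> (Y \<omega>) + 2 * psi d \<rho> (Z \<omega>)"])
    (use assms in \<open>auto intro!: psi_rv_measurable vec_rv_intros AE_I2 order_trans[OF psi_diff_le] simp: psi_nonneg\<close>)

lemma integrable_psi_X_diff:
  "integrable M (\<lambda>\<omega>. psi d \<rho> (X \<omega> - y))" "integrable M (\<lambda>\<omega>. psi d \<rho> (y - X' \<omega>))"
  "integrable M (\<lambda>\<omega>. psi d \<rho> (X \<omega> - X' \<omega>))"
  using integrable_psi_diff[OF vec_rv_intros(2) vec_rv_intros(1)[of M y]] integrable_psi_diff[OF vec_rv_intros(1)[of M y] vec_rv_intros(3)]
    integrable_psi_diff[OF vec_rv_intros(2,3)] integrable_psi_X by auto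

lemma psi_Fubini:
  assumes Y: "vec_rv M Y" and int: "integrable M (\<lambda>\<omega>. psi d \<rho> (Y \<omega>))"
  shows "integrable \<rho> (\<lambda>t. \<integral>\<omega>. 1 - cos (dot d (Y \<omega>) t) \<partial>M)"
    and "(\<integral>t. (\<integral>\<omega>. 1 - cos (dot d (Y \<omega>) t) \<partial>M) \<partial>\<rho>) = (\<integral>\<omega>. psi d \<rho> (Y \<omega>) \<partial>M)"
proof -
  have "integrable (M \<Otimes>\<^sub>M \<rho>) (\<lambda>(\<omega>, t). 1 - cos (dot d (Y \<omega>) t))"
  proof (rule Mrho.Fubini_integrable)
    show "(\<lambda>(\<omega>, t). 1 - cos (dot d (Y \<omega>) t)) \<in> borel_measurable (M \<Otimes>\<^sub>M \<rho>)"
      using dot_rv_pair[OF Y] by (simp add: case_prod_unfold)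
    show "integrable M (\<lambda>\<omega>. \<integral>t. norm (case (\<omega>, t) of (\<omega>, t) \<Rightarrow> 1 - cos (dot d (Y \<omega>) t)) \<partial>\<rho>)"
      using int by (simp add: psi_def)
  qed (simp add: integrable_psi)
  then show "integrable \<rho> (\<lambda>t. \<integral>\<omega>. 1 - cos (dot d (Y \<omega>) t) \<partial>M)"
    and "(\<integral>t. (\<integral>\<omega>. 1 - cos (dot d (Y \<omega>) t) \<partial>M) \<partial>\<rho>) = (\<integral>\<omega>. psi d \<rho> (Y \<omega>) \<partial>M)"
    using Mrho.integrable_snd Mrho.Fubini_integral by (auto simp: psi_def)
qed

section \<open>Centred characters and their Gram kernel\<close>

definition phi :: "(nat \<Rightarrow> real) \<Rightarrow> (nat \<Rightarrow> real) \<Rightarrow> complex" where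
  "phi x t = iexp (dot d x t) - char_vec M d X t"

lemma dot_X_measurable [measurable]:
  "(\<lambda>\<omega>. dot d (X \<omega>) t) \<in> borel_measurable M" "(\<lambda>\<omega>. dot d (X' \<omega>) t) \<in> borel_measurable M"
  using dot_rv[OF vec_rv_intros(2) vec_rv_intros(1)] dot_rv[OF vec_rv_intros(3) vec_rv_intros(1)] by auto

lemma integrable_iexp_cos_sin:
  assumes [measurable]: "f \<in> borel_measurable M"
  shows "integrable M (\<lambda>\<omega>. iexp (f \<omega>))" "integrable M (\<lambda>\<omega>. cos (f \<omega>))" "integrable M (\<lambda>\<omega>. sin (f \<omega>))"
  by (auto intro!: integrable_const_bound[of _ 1])

lemma char_vec_eq:
  "char_vec M d X t = Complex (\<integral>\<omega>. cos (dot d (X \<omega>) t) \<partial>M) (\<integral>\<omega>. sin (dot d (X \<omega>) t) \<partial>M)"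
proof -
  note i = integrable_iexp_cos_sin(1)[OF dot_X_measurable(1)[of t]]
  show ?thesis
    unfolding char_vec_def using integral_Re[OF i] integral_Im[OF i]
    by (simp add: complex_eq_iff Re_exp Im_exp)
qed

lemma same_law_integral:
  assumes [measurable]: "g \<in> borel_measurable borel"
  shows "(\<integral>\<omega>. g (dot d (X' \<omega>) t) \<partial>M) = (\<integral>\<omega>. g (dot d (X \<omega>) t) \<partial>M :: real)"
proof -
  have [measurable]: "(\<lambda>x. dot d x t) \<in> borel_measurable (euc d)"
    using dot_rv[OF vec_rv_intros(5) vec_rv_intros(1)] .
  have "(\<integral>\<omega>. g (dot d (X' \<omega>) t) \<partial>M) = (\<integral>x. g (dot d x t) \<partial>distr M (euc d) X')"
    by (rule integral_distr[symmetric]) measurable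
  also have "\<dots> = (\<integral>\<omega>. g (dot d (X \<omega>) t) \<partial>M)"
    unfolding same_law by (rule integral_distr) measurable
  finally show ?thesis .
qed

lemma indep_integral:
  fixes g :: "real \<Rightarrow> real"
  assumes [measurable]: "g \<in> borel_measurable borel" and bnd: "\<And>x. \<bar>g x\<bar> \<le> 1"
  shows "(\<integral>\<omega>. g (dot d (X \<omega>) t) * g (dot d (X' \<omega>) t) \<partial>M) = (\<integral>\<omega>. g (dot d (X \<omega>) t) \<partial>M)\<^sup>2"
proof -
  have m: "(\<lambda>x. g (dot d x t)) \<in> borel_measurable (euc d)"
    using dot_rv[OF vec_rv_intros(5) vec_rv_intros(1)] by measurable
  have "indep_var borel ((\<lambda>x. g (dot d x t)) \<circ> X) borel ((\<lambda>x. g (dot d x t)) \<circ> X')"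
    by (rule indep_var_compose[OF indep m m])
  then have iv: "indep_var borel (\<lambda>\<omega>. g (dot d (X \<omega>) t)) borel (\<lambda>\<omega>. g (dot d (X' \<omega>) t))"
    by (simp add: comp_def)
  have "(\<integral>\<omega>. g (dot d (X \<omega>) t) * g (dot d (X' \<omega>) t) \<partial>M) =
      (\<integral>\<omega>. g (dot d (X \<omega>) t) \<partial>M) * (\<integral>\<omega>. g (dot d (X' \<omega>) t) \<partial>M)"
    by (intro indep_var_lebesgue_integral iv integrable_const_bound[of _ 1]) (auto simp: bnd)
  then show ?thesis by (simp add: same_law_integral power2_eq_square)
qed

text \<open>Expanding the inner product gives four cosine terms, with expectations evaluated by
  independence and equality of laws. Their signs add up to 0, so each cosine can be replaced by
  \<open>1 - cos\<close> with opposite sign; only in this form is every term separately integrable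
  over \<open>\<rho>\<close>.\<close>

lemma phi_inner:
  "phi x t \<bullet> phi y t = - (1 - cos (dot d (x - y) t)) + (\<integral>\<omega>. 1 - cos (dot d (X \<omega> - y) t) \<partial>M)
     + (\<integral>\<omega>. 1 - cos (dot d (x - X' \<omega>) t) \<partial>M) - (\<integral>\<omega>. 1 - cos (dot d (X \<omega> - X' \<omega>) t) \<partial>M)"
proof -
  define C where "C = (\<integral>\<omega>. cos (dot d (X \<omega>) t) \<partial>M)"
  define S where "S = (\<integral>\<omega>. sin (dot d (X \<omega>) t) \<partial>M)"
  note int = integrable_iexp_cos_sin(2,3)[OF dot_X_measurable(1)[of t]] integrable_iexp_cos_sin(2,3)[OF dot_X_measurable(2)[of t]]
  have same: "(\<integral>\<omega>. cos (dot d (X' \<omega>) t) \<partial>M) = C" "(\<integral>\<omega>. sin (dot d (X' \<omega>) t) \<partial>M) = S"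
    by (simp_all add: C_def S_def same_law_integral)
  have 1: "(\<integral>\<omega>. 1 - cos (dot d (X \<omega> - y) t) \<partial>M) = 1 - (C * cos (dot d y t) + S * sin (dot d y t))"
    using int by (simp add: dot_diff cos_diff C_def S_def prob_space)
  have 2: "(\<integral>\<omega>. 1 - cos (dot d (x - X' \<omega>) t) \<partial>M) = 1 - (cos (dot d x t) * C + sin (dot d x t) * S)"
    using int by (simp add: dot_diff cos_diff same prob_space)
  have "integrable M (\<lambda>\<omega>. cos (dot d (X \<omega>) t) * cos (dot d (X' \<omega>) t))"
    "integrable M (\<lambda>\<omega>. sin (dot d (X \<omega>) t) * sin (dot d (X' \<omega>) t))"
    by (auto intro!: integrable_const_bound[of _ 1] AE_I2 mult_le_one simp: abs_mult)
  then have 3: "(\<integral>\<omega>. 1 - cos (dot d (X \<omega> - X' \<omega>) t) \<partial>M) = 1 - (C\<^sup>2 + S\<^sup>2)"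
    by (simp add: dot_diff cos_diff prob_space C_def S_def indep_integral)
  have "phi x t = Complex (cos (dot d x t) - C) (sin (dot d x t) - S)" for x
    by (simp add: phi_def char_vec_eq C_def S_def complex_eq_iff Re_exp Im_exp)
  then show ?thesis
    unfolding 1 2 3 by (simp add: inner_complex_def dot_diff cos_diff power2_eq_square algebra_simps)
qed

abbreviation PsiX :: "(nat \<Rightarrow> real) \<Rightarrow> (nat \<Rightarrow> real) \<Rightarrow> real" where
  "PsiX \<equiv> Psi M d \<rho> X X'"

lemma phi_inner_integral:
  "integrable \<rho> (\<lambda>t. phi x t \<bullet> phi y t)" "(\<integral>t. phi x t \<bullet> phi y t \<partial>\<rho>) = PsiX x y"
proof -
  note F = psi_Fubini[OF vec_rv_intros(6)[OF vec_rv_intros(2) vec_rv_intros(1)] integrable_psi_X_diff(1)[of y]]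
    psi_Fubini[OF vec_rv_intros(6)[OF vec_rv_intros(1) vec_rv_intros(3)] integrable_psi_X_diff(2)[of x]]
    psi_Fubini[OF vec_rv_intros(6)[OF vec_rv_intros(2,3)] integrable_psi_X_diff(3)]
  note i = integrable_psi[of "x - y"]
  show "integrable \<rho> (\<lambda>t. phi x t \<bullet> phi y t)"
    unfolding phi_inner by (intro Bochner_Integration.integrable_add Bochner_Integration.integrable_diff F i Bochner_Integration.integrable_minus)
  show "(\<integral>t. phi x t \<bullet> phi y t \<partial>\<rho>) = PsiX x y"
    unfolding phi_inner Psi_def psi_def[of d \<rho> "x - y"] F(2,4,6)[symmetric]
    by (simp only: Bochner_Integration.integral_add Bochner_Integration.integral_diff Bochner_Integration.integral_minus
        Bochner_Integration.integrable_add Bochner_Integration.integrable_diff Bochner_Integration.integrable_minus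
        F(1,3,5) i)
qed

lemma phi_measurable:
  assumes "vec_rv N Y" "vec_rv N Z"
  shows "(\<lambda>z. phi (Y z) (Z z)) \<in> borel_measurable N"
proof -
  have iexp: "iexp \<in> borel_measurable borel"
    by (intro borel_measurable_continuous_onI continuous_intros)
  have "(\<lambda>p. dot d (X (snd p)) (Z (fst p))) \<in> borel_measurable (N \<Otimes>\<^sub>M M)"
    by (rule dot_rv[OF vec_rv_snd[OF vec_rv_intros(2)] vec_rv_fst[OF assms(2)]])
  from measurable_compose[OF this iexp]
  have "(\<lambda>z. char_vec M d X (Z z)) \<in> borel_measurable N"
    unfolding char_vec_def by (intro borel_measurable_lebesgue_integral) (simp only: case_prod_unfold)
  with measurable_compose[OF dot_rv[OF assms] iexp] show ?thesis
    unfolding phi_def by (intro borel_measurable_diff)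
qed

lemma sq_integrable_phi: "sq_integrable \<rho> (phi x)"
  using phi_inner_integral(1)[of x x] phi_measurable[OF vec_rv_intros(1)[of \<rho> x] vec_rv_intros(4)]
  by (simp add: sq_integrable_def power2_norm_eq_inner)

text \<open>The complex product is considered besides the real inner product because only the former
  factorizes over the coordinates in \<open>S\<close>.\<close>

lemma integrable_phi_cnj: "integrable \<rho> (\<lambda>t. phi x t * cnj (phi y t))"
proof (rule Bochner_Integration.integrable_bound)
  show "integrable \<rho> (\<lambda>t. (cmod (phi x t))\<^sup>2 + (cmod (phi y t))\<^sup>2)"
    using sq_integrable_phi by (simp add: sq_integrable_def)
  show "(\<lambda>t. phi x t * cnj (phi y t)) \<in> borel_measurable \<rho>"
  proof (rule borel_measurable_times)
    have m: "phi z \<in> borel_measurable \<rho>" for z using sq_integrable_phi by (simp add: sq_integrable_def)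
    show "phi x \<in> borel_measurable \<rho>" by (rule m)
    have "cnj \<in> borel_measurable borel"
      by (intro borel_measurable_continuous_onI continuous_on_cnj continuous_on_id)
    with m show "(\<lambda>t. cnj (phi y t)) \<in> borel_measurable \<rho>" by (rule measurable_compose)
  qed
  have "cmod (phi x t) * cmod (phi y t) \<le> (cmod (phi x t))\<^sup>2 + (cmod (phi y t))\<^sup>2" for t
    using abs_inner_le_squares[of "cmod (phi x t)" "cmod (phi y t)"] by simp
  then show "AE t in \<rho>. norm (phi x t * cnj (phi y t)) \<le> norm ((cmod (phi x t))\<^sup>2 + (cmod (phi y t))\<^sup>2)"
    by (simp add: norm_mult)
qed

lemma phi_reflect: "phi x (\<lambda>k\<in>{..<d}. - t k) = cnj (phi x t)"
proof -
  have "dot d y (\<lambda>k\<in>{..<d}. - t k) = - dot d y t" for y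
    by (simp add: dot_def sum_negf)
  then show ?thesis
    by (simp add: phi_def char_vec_eq complex_eq_iff Re_exp Im_exp)
qed

text \<open>The real part is \<open>phi_inner_integral\<close>. The imaginary part is odd under
  reflection of \<open>t\<close>, so its integral over the symmetric measure is 0.\<close>

lemma integral_phi_cnj: "(\<integral>t. phi x t * cnj (phi y t) \<partial>\<rho>) = complex_of_real (PsiX x y)"
proof -
  note int = integrable_phi_cnj[of x y]
  let ?h = "\<lambda>t. Im (phi x t * cnj (phi y t))"
  let ?r = "\<lambda>t. \<lambda>k\<in>{..<d}. - t k :: real"
  have sets: "sets \<rho> = sets (euc d)" and sym: "distr \<rho> (euc d) ?r = \<rho>"
    using adm by (auto simp: admissible_measure_def symmetric_measure_def)
  have r: "?r \<in> measurable \<rho> (euc d)"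
    unfolding euc_def by (intro measurable_restrict borel_measurable_uminus component_measurable) auto
  have h: "?h \<in> borel_measurable (euc d)"
    using measurable_compose[OF borel_measurable_integrable[OF int] borel_measurable_Im]
    unfolding measurable_cong_sets[OF sets refl] .
  have "(\<integral>t. ?h t \<partial>\<rho>) = (\<integral>t. ?h t \<partial>distr \<rho> (euc d) ?r)" by (simp add: sym)
  also have "\<dots> = (\<integral>t. ?h (?r t) \<partial>\<rho>)" by (rule integral_distr[OF r h])
  also have "\<dots> = (\<integral>t. - ?h t \<partial>\<rho>)" by (simp add: phi_reflect)
  also have "\<dots> = - (\<integral>t. ?h t \<partial>\<rho>)" by (rule Bochner_Integration.integral_minus)
  finally have "(\<integral>t. ?h t \<partial>\<rho>) = 0" by simp
  moreover have "(\<integral>t. Re (phi x t * cnj (phi y t)) \<partial>\<rho>) = PsiX x y"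
    using phi_inner_integral(2)[of x y] by (simp add: inner_complex_def)
  ultimately show ?thesis
    unfolding complex_eq_iff by (simp add: integral_Re[OF int, symmetric] integral_Im[OF int, symmetric] del: integral_Re integral_Im)
qed

lemma PsiX_diag: "PsiX x x = (\<integral>t. (cmod (phi x t))\<^sup>2 \<partial>\<rho>)"
  using phi_inner_integral(2)[of x x] by (simp add: power2_norm_eq_inner)

lemma integrable_PsiX_diag: "integrable (distr M (euc d) X) (\<lambda>x. PsiX x x)"
proof -
  \<comment> \<open>Measurability is read off from the integral of the squared modulus of
    \<open>phi\<close>, which is jointly measurable.\<close>
  have [measurable]: "(\<lambda>x. PsiX x x) \<in> borel_measurable (euc d)"
  proof -
    have "(\<lambda>(x, t). phi x t) \<in> borel_measurable (euc d \<Otimes>\<^sub>M \<rho>)"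
      unfolding case_prod_unfold
      by (rule phi_measurable[OF vec_rv_fst[OF vec_rv_intros(5)] vec_rv_snd[OF vec_rv_intros(4)]])
    then show ?thesis unfolding PsiX_diag by measurable
  qed
  \<comment> \<open>The two nonpositive terms of \<open>Psi\<close> are dropped, and the other two
    are estimated by \<open>psi_diff_le\<close>.\<close>
  have bound: "PsiX x x \<le> 4 * psi d \<rho> x + 4 * (\<integral>\<omega>. psi d \<rho> (X \<omega>) + psi d \<rho> (X' \<omega>) \<partial>M)" for x
  proof -
    have "(\<integral>\<omega>. psi d \<rho> (X \<omega> - x) \<partial>M) \<le> (\<integral>\<omega>. 2 * psi d \<rho> (X \<omega>) + 2 * psi d \<rho> x \<partial>M)"
      using integrable_psi_X by (intro integral_mono integrable_psi_X_diff psi_diff_le) auto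
    moreover have "(\<integral>\<omega>. psi d \<rho> (x - X' \<omega>) \<partial>M) \<le> (\<integral>\<omega>. 2 * psi d \<rho> x + 2 * psi d \<rho> (X' \<omega>) \<partial>M)"
      using integrable_psi_X by (intro integral_mono integrable_psi_X_diff psi_diff_le) auto
    moreover have "0 \<le> (\<integral>\<omega>. psi d \<rho> (X \<omega> - X' \<omega>) \<partial>M)" "0 \<le> psi d \<rho> (x - x)"
      "0 \<le> (\<integral>\<omega>. psi d \<rho> (X \<omega>) \<partial>M)" "0 \<le> (\<integral>\<omega>. psi d \<rho> (X' \<omega>) \<partial>M)"
      by (simp_all add: psi_nonneg)
    ultimately show ?thesis
      using integrable_psi_X unfolding Psi_def by (simp add: prob_space)
  qed
  have "integrable M (\<lambda>\<omega>. PsiX (X \<omega>) (X \<omega>))"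
  proof (rule Bochner_Integration.integrable_bound)
    show "integrable M (\<lambda>\<omega>. 4 * psi d \<rho> (X \<omega>) + 4 * (\<integral>\<omega>. psi d \<rho> (X \<omega>) + psi d \<rho> (X' \<omega>) \<partial>M))"
      using integrable_psi_X by auto
    have "0 \<le> PsiX x x" for x by (simp add: PsiX_diag)
    then show "AE \<omega> in M. norm (PsiX (X \<omega>) (X \<omega>)) \<le>
        norm (4 * psi d \<rho> (X \<omega>) + 4 * (\<integral>\<omega>. psi d \<rho> (X \<omega>) + psi d \<rho> (X' \<omega>) \<partial>M))"
      using bound by (intro AE_I2) (simp add: order_trans[OF _ abs_ge_self])
  qed measurable
  then show ?thesis by (simp add: integrable_distr_eq)
qed

section \<open>Continuity of the kernels\<close>

definition vec_tendsto :: "(nat \<Rightarrow> nat \<Rightarrow> real) \<Rightarrow> (nat \<Rightarrow> real) \<Rightarrow> bool" where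
  "vec_tendsto z x \<longleftrightarrow> (\<forall>k<d. (\<lambda>m. z m k) \<longlonglongrightarrow> x k)"

lemma vec_tendsto_intros:
  "vec_tendsto (\<lambda>_. x) x" "vec_tendsto z x \<Longrightarrow> vec_tendsto w y \<Longrightarrow> vec_tendsto (\<lambda>m. z m - w m) (x - y)"
  by (auto simp: vec_tendsto_def intro: tendsto_diff)

lemma dot_tendsto:
  assumes "vec_tendsto z x" "vec_tendsto w y"
  shows "(\<lambda>m. dot d (z m) (w m)) \<longlonglongrightarrow> dot d x y"
  unfolding dot_def using assms by (intro tendsto_sum tendsto_mult) (auto simp: vec_tendsto_def)

lemma dot_bounded:
  assumes "vec_tendsto z x"
  obtains B where "\<And>m. dot d (z m) (z m) \<le> B" "B \<ge> 0"
proof -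
  have "Bseq (\<lambda>m. dot d (z m) (z m))"
    using dot_tendsto[OF assms assms] by (intro convergent_imp_Bseq convergentI)
  then obtain B where "B > 0" "\<And>m. norm (dot d (z m) (z m)) \<le> B" unfolding Bseq_def by blast
  then have "dot d (z m) (z m) \<le> B" for m by (metis abs_le_D1 real_norm_def)
  with \<open>B > 0\<close> show ?thesis by (intro that[of B]) auto
qed

text \<open>A convergent sequence is bounded, so \<open>one_minus_cos_dot_le\<close> supplies one
  integrable majorant for the whole sequence.\<close>

lemma psi_tendsto:
  assumes z: "vec_tendsto z x"
  shows "(\<lambda>m. psi d \<rho> (z m)) \<longlonglongrightarrow> psi d \<rho> x"
proof -
  obtain B where B: "\<And>m. dot d (z m) (z m) \<le> B" "B \<ge> 0" using dot_bounded[OF z] by blast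
  show ?thesis
    unfolding psi_def
  proof (rule integral_dominated_convergence[where w = "\<lambda>t. (2 + B) * min 1 (dot d t t)"])
    show "AE t in \<rho>. (\<lambda>m. 1 - cos (dot d (z m) t)) \<longlonglongrightarrow> 1 - cos (dot d x t)"
      by (intro AE_I2 tendsto_intros tendsto_cos dot_tendsto z vec_tendsto_intros)
    have nn: "0 \<le> dot d t t" for t by (simp add: dot_def sum_nonneg)
    show "AE t in \<rho>. norm (1 - cos (dot d (z m) t)) \<le> (2 + B) * min 1 (dot d t t)" for m
    proof (rule AE_I2)
      fix t
      have "1 - cos (dot d (z m) t) \<le> (2 + dot d (z m) (z m)) * min 1 (dot d t t)"
        by (rule one_minus_cos_dot_le)
      also have "\<dots> \<le> (2 + B) * min 1 (dot d t t)"
        using B nn by (intro mult_right_mono) auto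
      finally show "norm (1 - cos (dot d (z m) t)) \<le> (2 + B) * min 1 (dot d t t)" by simp
    qed
  qed (use integrable_min in auto)
qed

text \<open>Stated abstractly in order to treat \<open>X - w m\<close> and \<open>z m - X'\<close>
  alike: \<open>V\<close> is the random part, \<open>z m\<close> the moving point, and the bounded
  numbers \<open>psi (z m)\<close> complete the majorant.\<close>

lemma expectation_psi_tendsto:
  assumes Z: "\<And>\<omega>. vec_tendsto (\<lambda>m. Z m \<omega>) (Y \<omega>)" and z: "vec_tendsto z x"
    and le: "\<And>m \<omega>. psi d \<rho> (Z m \<omega>) \<le> 2 * psi d \<rho> (V \<omega>) + 2 * psi d \<rho> (z m)"
    and V: "integrable M (\<lambda>\<omega>. psi d \<rho> (V \<omega>))"
    and rv: "vec_rv M Y" "\<And>m. vec_rv M (Z m)"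
  shows "(\<lambda>m. \<integral>\<omega>. psi d \<rho> (Z m \<omega>) \<partial>M) \<longlonglongrightarrow> (\<integral>\<omega>. psi d \<rho> (Y \<omega>) \<partial>M)"
proof -
  have "Bseq (\<lambda>m. psi d \<rho> (z m))"
    using psi_tendsto[OF z] by (intro convergent_imp_Bseq convergentI)
  then obtain B where B: "\<And>m. psi d \<rho> (z m) \<le> B" unfolding Bseq_def by (auto simp: psi_nonneg)
  show ?thesis
  proof (rule integral_dominated_convergence[where w = "\<lambda>\<omega>. 2 * psi d \<rho> (V \<omega>) + 2 * B"])
    show "AE \<omega> in M. norm (psi d \<rho> (Z m \<omega>)) \<le> 2 * psi d \<rho> (V \<omega>) + 2 * B" for m
    proof (rule AE_I2)
      fix \<omega>
      show "norm (psi d \<rho> (Z m \<omega>)) \<le> 2 * psi d \<rho> (V \<omega>) + 2 * B"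
        using le[of m \<omega>] B[of m] psi_nonneg[of "Z m \<omega>"] unfolding real_norm_def by linarith
    qed
  qed (use V rv in \<open>auto intro!: psi_rv_measurable psi_tendsto Z\<close>)
qed

lemma PsiX_tendsto:
  assumes z: "vec_tendsto z x" and w: "vec_tendsto w y"
  shows "(\<lambda>m. PsiX (z m) (w m)) \<longlonglongrightarrow> PsiX x y"
  unfolding Psi_def
proof (intro tendsto_intros psi_tendsto vec_tendsto_intros z w)
  show "(\<lambda>m. \<integral>\<omega>. psi d \<rho> (X \<omega> - w m) \<partial>M) \<longlonglongrightarrow> (\<integral>\<omega>. psi d \<rho> (X \<omega> - y) \<partial>M)"
    by (rule expectation_psi_tendsto[OF _ w psi_diff_le])
      (auto intro!: vec_tendsto_intros w vec_rv_intros integrable_psi_X)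
  show "(\<lambda>m. \<integral>\<omega>. psi d \<rho> (z m - X' \<omega>) \<partial>M) \<longlonglongrightarrow> (\<integral>\<omega>. psi d \<rho> (x - X' \<omega>) \<partial>M)"
    by (rule expectation_psi_tendsto[OF _ z, of _ _ X'])
      (auto intro!: vec_tendsto_intros z vec_rv_intros integrable_psi_X order_trans[OF psi_diff_le])
qed

end

subsection \<open>Products of coordinates\<close>

context
  fixes I :: "'i set" and N :: "'i \<Rightarrow> 'a measure"
  assumes fin: "finite I" and sf: "\<And>i. i \<in> I \<Longrightarrow> sigma_finite_measure (N i)"
begin

lemma
  shows sigma_finite_PiM: "sigma_finite_measure (PiM I N)"
    and integrable_PiM_prod: "\<And>f. (\<And>i. i \<in> I \<Longrightarrow> integrable (N i) (f i)) \<Longrightarrow>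
      integrable (PiM I N) (\<lambda>x. \<Prod>i\<in>I. f i (x i) :: 'b::{real_normed_field,banach,second_countable_topology})"
    and integral_PiM_prod: "\<And>f. (\<And>i. i \<in> I \<Longrightarrow> integrable (N i) (f i)) \<Longrightarrow>
      (\<integral>x. (\<Prod>i\<in>I. f i (x i) :: 'b) \<partial>PiM I N) = (\<Prod>i\<in>I. integral\<^sup>L (N i) (f i))"
proof -
  \<comment> \<open>\<open>product_sigma_finite\<close> speaks about all indices; outside
    \<open>I\<close> the measures are replaced by a trivial one, which leaves the product over
    \<open>I\<close> unchanged.\<close>
  define N' where "N' i = (if i \<in> I then N i else count_space {})" for i
  have eq: "PiM I N = PiM I N'"
    by (rule PiM_cong) (auto simp: N'_def)
  have "sigma_finite_measure (N' i)" for i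
    using sf by (simp add: N'_def sigma_finite_measure_count_space_finite)
  then interpret product_sigma_finite N' by (simp add: product_sigma_finite_def)
  show "sigma_finite_measure (PiM I N)"
    unfolding eq by (rule sigma_finite[OF fin])
  fix f :: "'i \<Rightarrow> 'a \<Rightarrow> 'b"
  assume "\<And>i. i \<in> I \<Longrightarrow> integrable (N i) (f i)"
  then have i: "\<And>i. i \<in> I \<Longrightarrow> integrable (N' i) (f i)" by (simp add: N'_def)
  show "integrable (PiM I N) (\<lambda>x. \<Prod>i\<in>I. f i (x i))"
    unfolding eq by (rule product_integrable_prod[OF fin i])
  show "(\<integral>x. (\<Prod>i\<in>I. f i (x i)) \<partial>PiM I N) = (\<Prod>i\<in>I. integral\<^sup>L (N i) (f i))"
    unfolding eq by (subst product_integral_prod[OF fin i]) (auto simp: N'_def)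
qed

end

text \<open>Independence and equality of laws are given for the joint vectors; composing with the
  projection to coordinate \<open>i\<close> passes them on.\<close>

lemma coordinateI:
  assumes M: "prob_space M" and "admissible_measure (d i) (\<rho> i)"
    and copy: "independent_copy M n d X X'"
    and psi: "(\<integral>\<^sup>+ \<omega>. ennreal (psi (d i) (\<rho> i) (X i \<omega>)) \<partial>M) < \<infinity>" and i: "i \<in> {1..n}"
  shows "coordinate M (d i) (\<rho> i) (X i) (X' i)"
proof -
  interpret prob_space M by (rule M)
  let ?E = "PiM {1..n} (\<lambda>i. euc (d i))"
  let ?V = "\<lambda>\<omega>. \<lambda>i\<in>{1..n}. X i \<omega>" and ?V' = "\<lambda>\<omega>. \<lambda>i\<in>{1..n}. X' i \<omega>"
  have iv: "indep_var ?E ?V ?E ?V'" and eq: "distr M ?E ?V' = distr M ?E ?V"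
    using copy by (auto simp: independent_copy_def Let_def)
  have p: "(\<lambda>v. v i) \<in> measurable ?E (euc (d i))"
    by (rule measurable_component_singleton[OF i])
  have comp: "(\<lambda>v. v i) \<circ> ?V = X i" "(\<lambda>v. v i) \<circ> ?V' = X' i"
    using i by (auto simp: fun_eq_iff)
  have "indep_var (euc (d i)) (X i) (euc (d i)) (X' i)"
    using indep_var_compose[OF iv p p] unfolding comp .
  moreover have "distr M (euc (d i)) (X' i) = distr M (euc (d i)) (X i)"
    using distr_distr[OF p indep_var_rv2[OF iv]] distr_distr[OF p indep_var_rv1[OF iv]] eq
    unfolding comp by simp
  ultimately show ?thesis
    using assms by (simp add: coordinate_def coordinate_axioms_def)
qed

text \<open>Density is phrased through sequences because continuity of the kernels was obtained by
  dominated convergence. It will be applied to \<open>nat => nat => real\<close> with the product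
  topology.\<close>

lemma sequentially_dense_sequence:
  "\<exists>q :: nat \<Rightarrow> 'a::{metric_space,second_countable_topology}. \<forall>x. \<exists>r. (\<lambda>m. q (r m)) \<longlonglongrightarrow> x"
proof -
  obtain D :: "'a set" where D: "countable D" "\<And>U. open U \<Longrightarrow> U \<noteq> {} \<Longrightarrow> \<exists>y\<in>D. y \<in> U"
    using countable_dense_exists by blast
  have "D \<noteq> {}" using D(2)[of UNIV] by auto
  have "\<exists>r. (\<lambda>m. from_nat_into D (r m)) \<longlonglongrightarrow> x" for x
  proof -
    have "\<exists>j. dist (from_nat_into D j) x < 1 / Suc m" for m
    proof -
      obtain y where "y \<in> D" "y \<in> ball x (1 / Suc m)"
        using D(2)[of "ball x (1 / Suc m)"] by auto
      moreover then obtain j where "from_nat_into D j = y"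
        using from_nat_into_surj[OF D(1)] by blast
      ultimately show ?thesis by (auto simp: dist_commute intro!: exI[of _ j])
    qed
    then obtain r where r: "\<And>m. dist (from_nat_into D (r m)) x < 1 / Suc m" by metis
    have "(\<lambda>m. dist (from_nat_into D (r m)) x) \<longlonglongrightarrow> 0"
      by (rule tendsto_sandwich[OF _ _ tendsto_const LIMSEQ_Suc[OF lim_1_over_n]])
        (use r in \<open>auto intro!: always_eventually less_imp_le\<close>)
    then show ?thesis using tendsto_dist_iff by blast
  qed
  then show ?thesis by blast
qed

section \<open>The product kernel over \<open>S\<close>\<close>

locale coordinates =
  fixes M :: "'w measure" and n :: nat and d :: "nat \<Rightarrow> nat" and \<rho> :: "nat \<Rightarrow> (nat \<Rightarrow> real) measure"
    and X X' :: "nat \<Rightarrow> 'w \<Rightarrow> nat \<Rightarrow> real" and S :: "nat set"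
  assumes M: "prob_space M"
    and coord: "\<And>i. i \<in> {1..n} \<Longrightarrow> coordinate M (d i) (\<rho> i) (X i) (X' i)"
    and S: "S \<subseteq> {1..n}"
begin

definition e :: "(nat \<Rightarrow> nat \<Rightarrow> real) \<Rightarrow> (nat \<Rightarrow> nat \<Rightarrow> real) \<Rightarrow> complex" where
  "e x t = (\<Prod>i\<in>S. iexp (dot (d i) (x i) (t i)) - char_vec M (d i) (X i) (t i))"

abbreviation P where "P \<equiv> product_law M n d X"
abbreviation \<mu> where "\<mu> \<equiv> PiM S \<rho>"
abbreviation Psi' where "Psi' i \<equiv> Psi M (d i) (\<rho> i) (X i) (X' i)"

lemma fin_S: "finite S" using S finite_subset by blast

lemma coord_S: "i \<in> S \<Longrightarrow> coordinate M (d i) (\<rho> i) (X i) (X' i)" using coord S by blast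

lemma e_phi: "e x t = (\<Prod>i\<in>S. coordinate.phi M (d i) (X i) (x i) (t i))"
  unfolding e_def by (intro prod.cong refl) (simp add: coordinate.phi_def[OF coord_S])

lemma sigma_finite_\<rho>: "i \<in> S \<Longrightarrow> sigma_finite_measure (\<rho> i)"
  using coordinate.adm[OF coord_S] by (simp add: admissible_measure_def)

lemma sigma_finite_\<mu>: "sigma_finite_measure \<mu>"
  by (rule sigma_finite_PiM[OF fin_S sigma_finite_\<rho>])

lemma prob_space_law: "i \<in> {1..n} \<Longrightarrow> prob_space (distr M (euc (d i)) (X i))"
  by (rule prob_space.prob_space_distr[OF M coordinate.X_rv(1)[OF coord]])

lemma prob_space_P: "prob_space P"
  unfolding product_law_def by (rule prob_space_PiM[OF prob_space_law])

lemma e_cnj: "integrable \<mu> (\<lambda>t. e x t * cnj (e y t))"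
  "(\<integral>t. e x t * cnj (e y t) \<partial>\<mu>) = complex_of_real (\<Prod>i\<in>S. Psi' i (x i) (y i))"
proof -
  have eq: "e x t * cnj (e y t) =
      (\<Prod>i\<in>S. coordinate.phi M (d i) (X i) (x i) (t i) * cnj (coordinate.phi M (d i) (X i) (y i) (t i)))" for t
    by (simp add: e_phi prod.distrib)
  note i = coordinate.integrable_phi_cnj[OF coord_S]
  show "integrable \<mu> (\<lambda>t. e x t * cnj (e y t))"
    unfolding eq by (rule integrable_PiM_prod[OF fin_S sigma_finite_\<rho> i])
  show "(\<integral>t. e x t * cnj (e y t) \<partial>\<mu>) = complex_of_real (\<Prod>i\<in>S. Psi' i (x i) (y i))"
    unfolding eq of_real_prod
    by (subst integral_PiM_prod[OF fin_S sigma_finite_\<rho> i]) (auto simp: coordinate.integral_phi_cnj[OF coord_S])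
qed

lemma component_vec_rv:
  assumes i: "i \<in> S"
  shows "coordinate.vec_rv (d i) P (\<lambda>x. x i)" "coordinate.vec_rv (d i) \<mu> (\<lambda>t. t i)"
proof -
  interpret coordinate M "d i" "\<rho> i" "X i" "X' i" by (rule coord_S[OF i])
  have P: "(\<lambda>x. x i) \<in> measurable P (euc (d i))"
    using measurable_component_singleton[of i "{1..n}" "\<lambda>i. distr M (euc (d i)) (X i)"] i S
    unfolding product_law_def by (auto cong: measurable_cong_sets)
  have mu: "(\<lambda>t. t i) \<in> measurable \<mu> (\<rho> i)"
    by (rule measurable_component_singleton[OF i])
  show "vec_rv P (\<lambda>x. x i)" "vec_rv \<mu> (\<lambda>t. t i)"
    unfolding vec_rv_def
    using measurable_compose[OF P component_measurable(2)] measurable_compose[OF mu component_measurable(1)] by auto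
qed

lemma e_measurable_pair: "(\<lambda>(x, t). e x t) \<in> borel_measurable (P \<Otimes>\<^sub>M \<mu>)"
  unfolding case_prod_unfold e_phi
proof (rule borel_measurable_prod)
  fix i assume i: "i \<in> S"
  show "(\<lambda>z. coordinate.phi M (d i) (X i) (fst z i) (snd z i)) \<in> borel_measurable (P \<Otimes>\<^sub>M \<mu>)"
    by (rule coordinate.phi_measurable[OF coord_S[OF i] coordinate.vec_rv_fst[OF coord_S[OF i] component_vec_rv(1)[OF i]]
          coordinate.vec_rv_snd[OF coord_S[OF i] component_vec_rv(2)[OF i]]])
qed

lemma e_measurable: "e x \<in> borel_measurable \<mu>" "(\<lambda>x. e x t) \<in> borel_measurable P"
proof -
  show "e x \<in> borel_measurable \<mu>"
    unfolding e_phi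
  proof (rule borel_measurable_prod)
    fix i assume i: "i \<in> S"
    show "(\<lambda>t. coordinate.phi M (d i) (X i) (x i) (t i)) \<in> borel_measurable \<mu>"
      by (rule coordinate.phi_measurable[OF coord_S[OF i] coordinate.vec_rv_intros(1)[OF coord_S[OF i]]
            component_vec_rv(2)[OF i]])
  qed
  show "(\<lambda>x. e x t) \<in> borel_measurable P"
    unfolding e_phi
  proof (rule borel_measurable_prod)
    fix i assume i: "i \<in> S"
    show "(\<lambda>x. coordinate.phi M (d i) (X i) (x i) (t i)) \<in> borel_measurable P"
      by (rule coordinate.phi_measurable[OF coord_S[OF i] component_vec_rv(1)[OF i]
            coordinate.vec_rv_intros(1)[OF coord_S[OF i]]])
  qed
qed

lemma sq_integrable_e: "sq_integrable \<mu> (e x)"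
proof -
  have "e x t * cnj (e x t) = complex_of_real ((cmod (e x t))\<^sup>2)" for t
    by (rule complex_norm_square[symmetric])
  then have "integrable \<mu> (\<lambda>t. complex_of_real ((cmod (e x t))\<^sup>2))"
    using e_cnj(1)[of x x] by simp
  then show ?thesis
    using e_measurable unfolding complex_of_real_integrable_eq by (simp add: sq_integrable_def)
qed

text \<open>Valid for all functions \<open>x\<close> and \<open>y\<close>, inside
  \<open>space P\<close> or not. This matters because the dense sequence used later runs through the
  whole function type.\<close>

lemma L2_inner_e: "L2_inner \<mu> (e x) (e y) = (\<Prod>i\<in>S. Psi' i (x i) (y i))"
proof -
  have "L2_inner \<mu> (e x) (e y) = (\<integral>t. Re (e x t * cnj (e y t)) \<partial>\<mu>)"
    by (simp add: L2_inner_def inner_complex_def)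
  also have "\<dots> = Re (\<integral>t. e x t * cnj (e y t) \<partial>\<mu>)" by (rule integral_Re[OF e_cnj(1)])
  finally show ?thesis unfolding e_cnj(2) Re_complex_of_real .
qed

lemma integrable_L2_inner_e: "integrable P (\<lambda>x. L2_inner \<mu> (e x) (e x))"
proof -
  \<comment> \<open>\<open>P\<close> is a product over all of \<open>{1..n}\<close>, so the factors
    outside \<open>S\<close> are filled with the constant 1, which is integrable for a probability
    law.\<close>
  define f where "f i x = (if i \<in> S then Psi' i x x else 1)" for i x
  have "L2_inner \<mu> (e x) (e x) = (\<Prod>i\<in>{1..n}. f i (x i))" for x
    unfolding L2_inner_e f_def using S by (intro prod.mono_neutral_cong_left) auto
  moreover have "integrable P (\<lambda>x. \<Prod>i\<in>{1..n}. f i (x i))"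
    unfolding product_law_def
  proof (rule integrable_PiM_prod)
    fix i assume i: "i \<in> {1..n}"
    then interpret law: prob_space "distr M (euc (d i)) (X i)" by (rule prob_space_law)
    show "sigma_finite_measure (distr M (euc (d i)) (X i))" ..
    show "integrable (distr M (euc (d i)) (X i)) (f i)"
      using coordinate.integrable_PsiX_diag[OF coord[OF i]] by (cases "i \<in> S") (auto simp: f_def[abs_def])
  qed simp
  ultimately show ?thesis by simp
qed

text \<open>Each factor has modulus at most 2 and \<open>P\<close> is a probability measure, so for
  fixed \<open>t\<close> boundedness suffices.\<close>

lemma e_L2: "(\<lambda>x. e x t) \<in> L2 P"
proof -
  interpret P: prob_space P by (rule prob_space_P)
  interpret M: prob_space M by (rule M)
  have "cmod (e x t) \<le> (\<Prod>i\<in>S. 2)" for x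
    unfolding e_def prod_norm[symmetric]
  proof (rule prod_mono, intro conjI norm_ge_zero)
    fix i assume i: "i \<in> S"
    have "cmod (char_vec M (d i) (X i) (t i)) \<le> (\<integral>\<omega>. cmod (iexp (dot (d i) (X i \<omega>) (t i))) \<partial>M)"
      unfolding char_vec_def by (rule integral_norm_bound)
    also have "\<dots> = 1" by (simp add: M.prob_space)
    finally show "cmod (iexp (dot (d i) (x i) (t i)) - char_vec M (d i) (X i) (t i)) \<le> 2"
      by (intro order_trans[OF norm_triangle_ineq4]) simp
  qed
  then have "(cmod (e x t))\<^sup>2 \<le> (\<Prod>i\<in>S. 2)\<^sup>2" for x
    by (intro power_mono) auto
  then have "integrable P (\<lambda>x. (cmod (e x t))\<^sup>2)"
    using e_measurable(2) by (intro P.integrable_const_bound[of _ "(\<Prod>i\<in>S. 2)\<^sup>2"]) auto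
  then show ?thesis using e_measurable(2) by (simp add: L2_def)
qed

text \<open>The squared distance expands into three values of the Gram kernel, all converging to the
  diagonal value; the coefficients 1, -2 and 1 cancel.\<close>

lemma e_continuous:
  assumes "q \<longlonglongrightarrow> x"
  shows "(\<lambda>m. L2_inner \<mu> (\<lambda>t. e x t - e (q m) t) (\<lambda>t. e x t - e (q m) t)) \<longlonglongrightarrow> 0"
proof -
  \<comment> \<open>Product convergence is passed through two evaluations, first at \<open>i\<close>
    and then at \<open>k\<close>.\<close>
  have coords: "(\<lambda>m. q m i k) \<longlonglongrightarrow> x i k" for i k
  proof -
    have c: "isCont (\<lambda>y. y j) z" for j and z :: "nat \<Rightarrow> 'b::metric_space"
      using continuous_on_eq_continuous_at[OF open_UNIV, THEN iffD1, OF continuous_on_product_coordinates[of j]] by blast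
    show ?thesis
      by (rule isCont_tendsto_compose[OF c isCont_tendsto_compose[OF c assms]])
  qed
  have v: "coordinate.vec_tendsto (d i) (\<lambda>m. q m i) (x i)" if "i \<in> S" for i
    using coords by (simp add: coordinate.vec_tendsto_def[OF coord_S[OF that]])
  have c: "coordinate.vec_tendsto (d i) (\<lambda>m. x i) (x i)" if "i \<in> S" for i
    by (simp add: coordinate.vec_tendsto_def[OF coord_S[OF that]])
  have "(\<lambda>m. L2_inner \<mu> (e x) (e (q m))) \<longlonglongrightarrow> L2_inner \<mu> (e x) (e x)"
    unfolding L2_inner_e by (rule tendsto_prod, rule coordinate.PsiX_tendsto[OF coord_S c v])
  moreover have "(\<lambda>m. L2_inner \<mu> (e (q m)) (e (q m))) \<longlonglongrightarrow> L2_inner \<mu> (e x) (e x)"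
    unfolding L2_inner_e by (rule tendsto_prod, rule coordinate.PsiX_tendsto[OF coord_S v v])
  ultimately have "(\<lambda>m. L2_inner \<mu> (e x) (e x) - 2 * L2_inner \<mu> (e x) (e (q m)) + L2_inner \<mu> (e (q m)) (e (q m)))
      \<longlonglongrightarrow> L2_inner \<mu> (e x) (e x) - 2 * L2_inner \<mu> (e x) (e x) + L2_inner \<mu> (e x) (e x)"
    by (intro tendsto_intros)
  moreover have "L2_inner \<mu> (\<lambda>t. e x t - e y t) (\<lambda>t. e x t - e y t) = L2_inner \<mu> (e x) (e x) - 2 * L2_inner \<mu> (e x) (e y) + L2_inner \<mu> (e y) (e y)" for y
    by (simp add: L2_inner_diff_left L2_inner_diff_right sq_integrable_e sq_integrable_diff L2_inner_commute[of \<mu> "e y" "e x"])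
  ultimately show ?thesis by simp
qed

lemma e_separable:
  "\<exists>q :: nat \<Rightarrow> nat \<Rightarrow> nat \<Rightarrow> real. \<forall>x. \<forall>\<epsilon>>0. \<exists>j. L2_inner \<mu> (\<lambda>t. e x t - e (q j) t) (\<lambda>t. e x t - e (q j) t) < \<epsilon>"
proof -
  obtain q :: "nat \<Rightarrow> nat \<Rightarrow> nat \<Rightarrow> real" where q: "\<forall>x. \<exists>r. (\<lambda>m. q (r m)) \<longlonglongrightarrow> x"
    using sequentially_dense_sequence by blast
  show ?thesis
  proof (intro exI[of _ q] allI impI)
    fix x and \<epsilon> :: real assume "\<epsilon> > 0"
    obtain r where "(\<lambda>m. q (r m)) \<longlonglongrightarrow> x" using q by blast
    from order_tendstoD(2)[OF e_continuous[OF this] \<open>\<epsilon> > 0\<close>]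
    show "\<exists>j. L2_inner \<mu> (\<lambda>t. e x t - e (q j) t) (\<lambda>t. e x t - e (q j) t) < \<epsilon>"
      by (auto simp: eventually_sequentially)
  qed
qed

text \<open>Gram-Schmidt is applied to the countable family \<open>e (q j)\<close>. Its density in
  the image of \<open>e\<close> is what \<open>defect_tendsto_0\<close> requires for
  completeness.\<close>

lemma kernel_representation_e:
  assumes "wiener_integral M P I"
  obtains a where "kernel_representation M P I \<mu> e a"
proof -
  obtain q :: "nat \<Rightarrow> nat \<Rightarrow> nat \<Rightarrow> real" where q: "\<And>x \<epsilon>. \<epsilon> > 0 \<Longrightarrow> \<exists>j. L2_inner \<mu> (\<lambda>t. e x t - e (q j) t) (\<lambda>t. e x t - e (q j) t) < \<epsilon>"
    using e_separable by blast
  interpret P: prob_space P by (rule prob_space_P)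
  interpret M: prob_space M by (rule M)
  interpret mu: sigma_finite_measure \<mu> by (rule sigma_finite_\<mu>)
  have "kernel_representation M P I \<mu> e (gram_schmidt \<mu> (\<lambda>j. e (q j)))"
  proof
    show "wiener_integral M P I" by fact
    show "(\<lambda>n. defect \<mu> n (gram_schmidt \<mu> (\<lambda>j. e (q j))) (e x)) \<longlonglongrightarrow> 0" for x
      by (rule defect_tendsto_0[OF sq_integrable_e sq_integrable_e q])
    show "ortho_seq \<mu> UNIV (gram_schmidt \<mu> (\<lambda>j. e (q j)))"
      by (rule ortho_seq_gram_schmidt_UNIV[OF sq_integrable_e])
  qed (rule e_measurable_pair sq_integrable_e integrable_L2_inner_e e_L2)+
  then show thesis by (rule that)
qed

end

text \<open>The conclusion includes \<open>K \<in> proj_tensor\<close> because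
  \<open>double_integral\<close> constrains \<open>J\<close> only there, and integrability of the
  squared modulus because the Bochner integral of a nonintegrable function is 0 by
  convention.\<close>

theorem proposition4p6:
  fixes M :: "'w measure"
    and n :: nat
    and d :: "nat \<Rightarrow> nat"
    and X X' :: "nat \<Rightarrow> 'w \<Rightarrow> nat \<Rightarrow> real"
    and \<rho> :: "nat \<Rightarrow> (nat \<Rightarrow> real) measure"
    and S :: "nat set"
    and W :: "(nat \<Rightarrow> real) \<Rightarrow> 'w \<Rightarrow> real"
    and I :: "((nat \<Rightarrow> nat \<Rightarrow> real) \<Rightarrow> complex) \<Rightarrow> 'w \<Rightarrow> complex"
    and J :: "((nat \<Rightarrow> nat \<Rightarrow> real) \<times> (nat \<Rightarrow> nat \<Rightarrow> real) \<Rightarrow> complex) \<Rightarrow> 'w \<Rightarrow> complex"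
    and G :: "(nat \<Rightarrow> nat \<Rightarrow> real) \<Rightarrow> 'w \<Rightarrow> complex"
  assumes "prob_space M"
    and "\<And>i. i \<in> {1..n} \<Longrightarrow> d i \<ge> 1"
    and "\<And>i. i \<in> {1..n} \<Longrightarrow> admissible_measure (d i) (\<rho> i)"
    and "prob_space.indep_vars M (\<lambda>i. euc (d i)) X {1..n}"
    and "independent_copy M n d X X'"
    and "\<And>i. i \<in> {1..n} \<Longrightarrow> (\<integral>\<^sup>+ \<omega>. ennreal (psi (d i) (\<rho> i) (X i \<omega>)) \<partial>M) < \<infinity>"
    and "S \<subseteq> {1..n}" and "card S \<ge> 2"
    and "brownian_sheet M n W"
    and "sheet_integral M n d X W I"
    and "double_integral M (product_law M n d X) I J"
    and "G_version M d \<rho> X S I G"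
  defines "K \<equiv> (\<lambda>(x, y). complex_of_real (\<Prod>i\<in>S. Psi M (d i) (\<rho> i) (X i) (X' i) (x i) (y i)))"
  shows "K \<in> proj_tensor (product_law M n d X) \<and>
    (AE \<omega> in M. integrable (PiM S \<rho>) (\<lambda>t. (cmod (G t \<omega>))\<^sup>2) \<and>
       complex_of_real (\<integral>t. (cmod (G t \<omega>))\<^sup>2 \<partial>(PiM S \<rho>)) = J K \<omega>)"
proof -
  interpret c: coordinates M n d \<rho> X X' S
  proof (rule coordinates.intro)
    show "coordinate M (d i) (\<rho> i) (X i) (X' i)" if "i \<in> {1..n}" for i
      by (rule coordinateI[of M d i \<rho> n X X', OF assms(1) assms(3)[OF that] assms(5) assms(6)[OF that] that])
  qed fact+
  have "wiener_integral M (product_law M n d X) I"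
    using \<open>sheet_integral M n d X W I\<close> by (simp add: sheet_integral_def)
  then obtain a where "kernel_representation M (product_law M n d X) I (PiM S \<rho>) c.e a"
    by (rule c.kernel_representation_e)
  then interpret kernel_representation M "product_law M n d X" I "PiM S \<rho>" c.e a .
  interpret kernel_field M "product_law M n d X" I "PiM S \<rho>" c.e a G
    by standard (use \<open>G_version M d \<rho> X S I G\<close> in \<open>auto simp: G_version_def c.e_def\<close>)
  have K: "K (x, y) = complex_of_real (L2_inner (PiM S \<rho>) (c.e x) (c.e y))" for x y
    by (simp add: K_def c.L2_inner_e)
  show ?thesis
    using kernel_proj_tensor[of K, OF K] norm_square_eq_double_integral[OF assms(11) K] by blast
qed

end
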